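(* Let $\Psi:\mathbb{R}\to(0,\infty)$ be a bounded, nondecreasing $\mathcal{C}^2$ function with $\Psi(0)=\Psi'(0)=1$, let $\Psi(\infty)=\lim_{x\to\infty}\Psi(x)$, and assume that $\sum_{j=1}^\infty(\Psi(\infty)-\Psi(\kappa^j))<\infty$ for all $\kappa>1$. Let $h$ be the critical curve and $F$ the free energy of the recursion $v_{n+1}=u_n+v_n$, $u_{n+1}=u_n\Psi(v_{n+1})$ (defined in the context). Then for every $v\le0$ there exists $\mathbb{C}_v>0$ such that $$\lim_{\varepsilon\downarrow0}\varepsilon^{1/2}\log F(h(v)+\varepsilon,v)=-\mathbb{C}_v.$$ Moreover, $$\mathbb{C}_0=\frac12\lim_{v\to0-}\mathbb{C}_v=\frac{\pi}{\sqrt2}\log\Psi(\infty).$$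
   Context: For $(u_0,v_0)\in[0,\infty)\times\mathbb{R}$, let $(u_n,v_n)_{n\ge0}$ be the sequence with $v_{n+1}=u_n+v_n$ and $u_{n+1}=u_n\Psi(v_{n+1})$. The free energy is $F(u_0,v_0):=\liminf_{n\to\infty}\Psi(\infty)^{-n}u_n\in[0,\infty)$. The critical curve is $h(v):=\inf\{u\in[0,\infty):\text{the recursion started from }(u_0,v_0)=(u,v)\text{ satisfies }\lim_{n\to\infty}v_n=\infty\}$, $v\in\mathbb{R}$. *)

theory Defs
  imports "HOL-Analysis.Analysis"
begin

definition C2_real :: "(real \<Rightarrow> real) \<Rightarrow> bool" where
  "C2_real f \<longleftrightarrow>
     (\<forall>x. f field_differentiable (at x)) \<and>
     (\<forall>x. deriv f field_differentiable (at x)) \<and>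
     continuous_on UNIV (deriv (deriv f))"

primrec orbit :: "(real \<Rightarrow> real) \<Rightarrow> real \<Rightarrow> real \<Rightarrow> nat \<Rightarrow> real \<times> real" where
  "orbit \<Psi> u0 v0 0 = (u0, v0)"
| "orbit \<Psi> u0 v0 (Suc n) =
     (let u = fst (orbit \<Psi> u0 v0 n); v = snd (orbit \<Psi> u0 v0 n)
      in (u * \<Psi> (u + v), u + v))"

definition u_seq :: "(real \<Rightarrow> real) \<Rightarrow> real \<Rightarrow> real \<Rightarrow> nat \<Rightarrow> real" where
  "u_seq \<Psi> u0 v0 n = fst (orbit \<Psi> u0 v0 n)"

definition v_seq :: "(real \<Rightarrow> real) \<Rightarrow> real \<Rightarrow> real \<Rightarrow> nat \<Rightarrow> real" where
  "v_seq \<Psi> u0 v0 n = snd (orbit \<Psi> u0 v0 n)"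

definition Psi_inf :: "(real \<Rightarrow> real) \<Rightarrow> real" where
  "Psi_inf \<Psi> = Lim at_top \<Psi>"

(* The library's liminf needs a complete lattice, hence the passage through ereal.
   For nondecreasing, positive, bounded \<Psi> and u0 \<ge> 0 the sequence below is nonincreasing
   and nonnegative, so its liminf lies in [0, \<infinity>) and real_of_ereal loses nothing.
   Since ln 0 = 0, a nonzero limit of a vanishing factor times ln F forces F > 0 eventually. *)
definition free_energy :: "(real \<Rightarrow> real) \<Rightarrow> real \<Rightarrow> real \<Rightarrow> real" where
  "free_energy \<Psi> u0 v0 =
     real_of_ereal (liminf (\<lambda>n. ereal (inverse (Psi_inf \<Psi> ^ n) * u_seq \<Psi> u0 v0 n)))"

(* The infimum of reals is meaningful here: the set is bounded below by 0, and it is nonempty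
   when \<Psi> is positive and nondecreasing with \<Psi> 0 = 1, as every u > max 0 (- v) belongs to it. *)
definition critical_curve :: "(real \<Rightarrow> real) \<Rightarrow> real \<Rightarrow> real" where
  "critical_curve \<Psi> v = Inf {u. 0 \<le> u \<and> filterlim (v_seq \<Psi> u v) at_top sequentially}"

end

theory Submission
  imports Defs
begin

text \<open>
  Close to \<open>v = 0\<close> the recursion is a discretisation of \<open>du/dv = \<Psi>(v) - 1\<close>, so the energy \<open>u - G(v)\<close>
  with \<open>G' = \<Psi> - 1\<close> and \<open>G(0) = 0\<close>, roughly \<open>u - v\<^sup>2 / 2\<close>, is nearly conserved. The critical orbit
  has energy close to zero and converges to \<open>(0, 0)\<close>. An orbit of small energy \<open>\<delta> > 0\<close> follows the
  parabola \<open>u = \<delta> + v\<^sup>2 / 2\<close>, and since \<open>u\<close> is the velocity of \<open>v\<close>, the time it spends near \<open>0\<close> is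
  \<open>\<integral> dv / (\<delta> + v\<^sup>2 / 2)\<close>, which is \<open>\<pi> sqrt (2 / \<delta>)\<close> for a passage from the left and half of that for a
  start at \<open>v = 0\<close>. During this time \<open>u\<close> hardly grows compared with \<open>\<Psi>(\<infinity>)\<^sup>n\<close>, and afterwards it
  grows at that rate up to a bounded factor, by the summability assumption
  (\<open>free_energy_after_escape\<close>). Hence \<open>log F\<close> is, to leading order, \<open>- log \<Psi>(\<infinity>)\<close> times the
  passage time. This also explains the factor two between the constant at \<open>v = 0\<close> and the limit from the left.

  It remains to relate \<open>\<delta>\<close> to \<open>\<epsilon>\<close> when the orbit starts at \<open>(h(v) + \<epsilon>, v)\<close> with \<open>v < 0\<close>. The energy itself
  changes on the way to \<open>0\<close> by amounts that are not small compared with \<open>\<epsilon>\<close>, so it is compared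
  with the energy of the critical orbit at the same time. The change of this excess in one step is
  bounded by a constant times the step times the excess (\<open>excess_step\<close>); as the steps sum to the
  distance travelled, the excess is conserved up to a factor close to one near \<open>0\<close>
  (\<open>excess_ratio\<close>). At a fixed time it is asymptotically linear in \<open>\<epsilon>\<close>, because orbits depend
  differentiably on their start. Together this gives \<open>\<delta> \<sim> c \<epsilon>\<close> with some \<open>c > 0\<close> that depends on \<open>v\<close>
  and tends to \<open>1\<close> as \<open>v\<close> tends to \<open>0\<close> (\<open>slope_limit\<close>). The energy of the critical orbit is of third
  order in its position and therefore negligible (\<open>critical_energy\<close>), so the orbit does follow the
  parabola (\<open>near_parabola\<close>), and a discrete clock built from the arctangent counts its steps
  (\<open>passage\<close>).
\<close>

section \<open>Elementary estimates\<close>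

text \<open>The mean value inequality around \<open>0\<close>; applied repeatedly it gives the Taylor bounds below.\<close>

lemma bound_from_deriv:
  fixes f f' :: "real \<Rightarrow> real"
  assumes "f 0 = 0" "\<And>t. \<bar>t\<bar> \<le> \<bar>x\<bar> \<Longrightarrow> (f has_real_derivative f' t) (at t)"
    and "\<And>t. \<bar>t\<bar> \<le> \<bar>x\<bar> \<Longrightarrow> \<bar>f' t\<bar> \<le> B"
  shows "\<bar>f x\<bar> \<le> B * \<bar>x\<bar>"
proof -
  have "norm (f x - f 0) \<le> B * norm (x - 0)"
    by (rule field_differentiable_bound[of "{-\<bar>x\<bar>..\<bar>x\<bar>}" f f'])
       (use assms in \<open>auto intro: has_field_derivative_at_within\<close>)
  then show ?thesis using assms(1) by simp
qed

lemma exp_minus_double_le: "0 \<le> x \<Longrightarrow> x \<le> 1/2 \<Longrightarrow> exp (-2 * x) \<le> 1 - x" for x :: real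
proof -
  assume x: "0 \<le> x" "x \<le> 1/2"
  have "1 + (1 - 2 * x) * x \<ge> 1" using x by simp
  also have "1 + (1 - 2 * x) * x = (1 + 2 * x) * (1 - x)" by (simp add: algebra_simps)
  also have "\<dots> \<le> exp (2 * x) * (1 - x)" using x by (intro mult_right_mono exp_ge_add_one_self) auto
  finally have "exp (-2 * x) * 1 \<le> exp (-2 * x) * (exp (2 * x) * (1 - x))" by (intro mult_left_mono) auto
  then show ?thesis by (simp add: mult.assoc[symmetric] flip: exp_add)
qed

text \<open>The quality of all estimates is governed by the size \<open>\<eta>\<close> of the window around \<open>0\<close> in which an
orbit is observed, while the asymptotics in \<open>\<epsilon>\<close> are taken for fixed \<open>\<eta>\<close>. This is the squeeze
argument that lets \<open>\<eta>\<close> tend to \<open>0\<close> last.\<close>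

lemma tendsto_of_eventual_bounds:
  fixes f :: "'a \<Rightarrow> real" and lo hi :: "real \<Rightarrow> real"
  assumes "0 < r"
    and bounds: "\<And>\<eta>. 0 < \<eta> \<Longrightarrow> \<eta> \<le> r \<Longrightarrow> \<forall>\<^sub>F x in F. lo \<eta> \<le> f x \<and> f x \<le> hi \<eta>"
    and lim: "(lo \<longlongrightarrow> l) (at_right 0)" "(hi \<longlongrightarrow> l) (at_right 0)"
  shows "(f \<longlongrightarrow> l) F"
proof (rule order_tendstoI)
  have r: "\<forall>\<^sub>F \<eta> in at_right 0. 0 < \<eta> \<and> \<eta> \<le> r"
    using \<open>0 < r\<close> by (auto simp: eventually_at_right_field intro!: exI[of _ r])
  { fix a assume "a < l"
    then have "\<forall>\<^sub>F \<eta> in at_right 0. a < lo \<eta>" using lim by (auto dest: order_tendstoD)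
    with r have "\<forall>\<^sub>F \<eta> in at_right 0. (0 < \<eta> \<and> \<eta> \<le> r) \<and> a < lo \<eta>" by (rule eventually_conj)
    then obtain \<eta> where "0 < \<eta>" "\<eta> \<le> r" "a < lo \<eta>"
      using eventually_happens trivial_limit_at_right_real by blast
    then show "\<forall>\<^sub>F x in F. a < f x" using bounds[of \<eta>] by (auto elim: eventually_mono) }
  { fix a assume "l < a"
    then have "\<forall>\<^sub>F \<eta> in at_right 0. hi \<eta> < a" using lim by (auto dest: order_tendstoD)
    with r have "\<forall>\<^sub>F \<eta> in at_right 0. (0 < \<eta> \<and> \<eta> \<le> r) \<and> hi \<eta> < a" by (rule eventually_conj)
    then obtain \<eta> where "0 < \<eta>" "\<eta> \<le> r" "hi \<eta> < a"
      using eventually_happens trivial_limit_at_right_real by blast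
    then show "\<forall>\<^sub>F x in F. f x < a" using bounds[of \<eta>] by (auto elim: eventually_mono) }
qed

section \<open>Orbits of the recursion\<close>

locale recursion =
  fixes \<Psi> :: "real \<Rightarrow> real"
  assumes pos: "\<And>x. \<Psi> x > 0"
    and bdd: "bounded (range \<Psi>)"
    and mono: "mono \<Psi>"
    and C2: "C2_real \<Psi>"
    and at_0: "\<Psi> 0 = 1"
    and deriv_at_0: "deriv \<Psi> 0 = 1"
    and summable_deficit: "\<And>\<kappa>::real. \<kappa> > 1 \<Longrightarrow> summable (\<lambda>j. Psi_inf \<Psi> - \<Psi> (\<kappa> ^ Suc j))"
begin

lemma has_deriv: "(\<Psi> has_real_derivative deriv \<Psi> x) (at x)"
  using C2 by (simp add: C2_real_def field_differentiable_derivI)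

lemma has_deriv2: "(deriv \<Psi> has_real_derivative deriv (deriv \<Psi>) x) (at x)"
  using C2 by (simp add: C2_real_def field_differentiable_derivI)

lemma isCont: "isCont \<Psi> x"
  using has_deriv DERIV_isCont by blast

lemma Psi_mono: "x \<le> y \<Longrightarrow> \<Psi> x \<le> \<Psi> y"
  using mono by (rule monoD)

lemma tendsto_Psi_inf: "(\<Psi> \<longlongrightarrow> Psi_inf \<Psi>) at_top"
proof -
  have bdd': "bdd_above (range \<Psi>)"
    using bdd by (rule bounded_imp_bdd_above)
  have "(\<Psi> \<longlongrightarrow> Sup (range \<Psi>)) at_top"
  proof (rule order_tendstoI)
    fix a assume "a < Sup (range \<Psi>)"
    then obtain x where x: "a < \<Psi> x"
      using less_cSup_iff[OF _ bdd'] by auto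
    show "\<forall>\<^sub>F x in at_top. a < \<Psi> x"
      using eventually_ge_at_top[of x]
      by eventually_elim (use x Psi_mono in \<open>blast intro: less_le_trans\<close>)
  next
    fix a assume "Sup (range \<Psi>) < a"
    then show "\<forall>\<^sub>F x in at_top. \<Psi> x < a"
      by (intro always_eventually allI) (meson bdd' cSUP_upper UNIV_I le_less_trans)
  qed
  then show ?thesis
    unfolding Psi_inf_def by (metis tendsto_Lim trivial_limit_at_top_linorder)
qed

lemma le_Psi_inf: "\<Psi> x \<le> Psi_inf \<Psi>"
proof (rule tendsto_lowerbound[OF tendsto_Psi_inf])
  show "\<forall>\<^sub>F y in at_top. \<Psi> x \<le> \<Psi> y"
    using eventually_ge_at_top[of x] by eventually_elim (rule Psi_mono)
qed simp

lemma ge_1: "0 \<le> x \<Longrightarrow> 1 \<le> \<Psi> x"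
  using Psi_mono at_0 by metis

lemma gt_1: assumes "0 < x" shows "1 < \<Psi> x"
proof -
  obtain d where d: "d > 0" "\<And>h. 0 < h \<Longrightarrow> h < d \<Longrightarrow> \<Psi> 0 < \<Psi> (0 + h)"
    using DERIV_pos_inc_right[OF has_deriv[of 0]] deriv_at_0 by auto
  have "1 < \<Psi> (min x (d/2))"
    using d(2)[of "min x (d/2)"] d(1) assms at_0 by auto
  also have "\<dots> \<le> \<Psi> x" by (auto intro: Psi_mono)
  finally show ?thesis .
qed

lemma lt_1: assumes "x < 0" shows "\<Psi> x < 1"
proof -
  obtain d where d: "d > 0" "\<And>h. 0 < h \<Longrightarrow> h < d \<Longrightarrow> \<Psi> (0 - h) < \<Psi> 0"
    using DERIV_pos_inc_left[OF has_deriv[of 0]] deriv_at_0 by auto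
  have "\<Psi> x \<le> \<Psi> (- min (-x) (d/2))" by (auto intro: Psi_mono)
  also have "\<dots> < 1"
    using d(2)[of "min (-x) (d/2)"] d(1) assms at_0 by auto
  finally show ?thesis .
qed

lemma Psi_inf_gt_1: "1 < Psi_inf \<Psi>"
  using gt_1[of 1] le_Psi_inf[of 1] by simp

text \<open>Orbits as bare sequences: two of them are compared at equal times, where only the recursion and
  the sign of the steps matter.\<close>

definition is_orbit :: "(nat \<Rightarrow> real) \<Rightarrow> (nat \<Rightarrow> real) \<Rightarrow> bool" where
  "is_orbit u v \<longleftrightarrow>
     0 \<le> u 0 \<and> (\<forall>n. v (Suc n) = u n + v n \<and> u (Suc n) = u n * \<Psi> (v (Suc n)))"

lemma is_orbit_seq: "0 \<le> u0 \<Longrightarrow> is_orbit (u_seq \<Psi> u0 v0) (v_seq \<Psi> u0 v0)"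
  by (simp add: is_orbit_def u_seq_def v_seq_def Let_def)

lemma seq_0 [simp]: "u_seq \<Psi> u0 v0 0 = u0" "v_seq \<Psi> u0 v0 0 = v0"
  by (simp_all add: u_seq_def v_seq_def)

lemma seq_Suc:
  "v_seq \<Psi> u0 v0 (Suc n) = u_seq \<Psi> u0 v0 n + v_seq \<Psi> u0 v0 n"
  "u_seq \<Psi> u0 v0 (Suc n) = u_seq \<Psi> u0 v0 n * \<Psi> (u_seq \<Psi> u0 v0 n + v_seq \<Psi> u0 v0 n)"
  by (simp_all add: u_seq_def v_seq_def Let_def)

context
  fixes u v :: "nat \<Rightarrow> real"
  assumes orbit: "is_orbit u v"
begin

lemma v_Suc: "v (Suc n) = u n + v n" and u_Suc: "u (Suc n) = u n * \<Psi> (v (Suc n))"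
  using orbit by (auto simp: is_orbit_def)

lemma u_nonneg: "0 \<le> u n"
proof (induction n)
  case 0 then show ?case using orbit by (simp add: is_orbit_def)
next
  case (Suc n) then show ?case using pos[of "v (Suc n)"] by (simp add: u_Suc)
qed

lemma u_pos: "0 < u 0 \<Longrightarrow> 0 < u n"
  by (induction n) (auto simp: u_Suc pos)

lemma v_mono: "m \<le> n \<Longrightarrow> v m \<le> v n"
  by (rule lift_Suc_mono_le[of v]) (auto simp: v_Suc u_nonneg)

lemma u_mono_right:
  assumes "0 \<le> v m" "m \<le> n" shows "u m \<le> u n"
  using assms(2)
proof (induction n rule: dec_induct)
  case (step n)
  have "1 \<le> \<Psi> (v (Suc n))" using step v_mono[of m "Suc n"] assms(1) ge_1 by force
  then have "u n * 1 \<le> u (Suc n)" unfolding u_Suc using u_nonneg by (intro mult_left_mono) auto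
  then show ?case using step by simp
qed simp

text \<open>Once the position is positive the steps no longer shrink, so the position grows at least
  linearly.\<close>

lemma diverges:
  assumes "0 < u 0" "0 < v m" shows "filterlim v at_top sequentially"
proof -
  have lb: "v m + real k * u m \<le> v (m + k)" for k
  proof (induction k)
    case (Suc k)
    have "u m \<le> u (m + k)" using u_mono_right[of m "m+k"] assms by simp
    then show ?case using Suc v_Suc[of "m+k"] by (simp add: algebra_simps)
  qed simp
  have "filterlim (\<lambda>k. v m + real k * u m) at_top sequentially"
    using u_pos[OF assms(1), of m] 
    by (intro filterlim_tendsto_add_at_top[OF tendsto_const]
         filterlim_at_top_mult_tendsto_pos[OF tendsto_const _ filterlim_real_sequentially])
  then have "filterlim (\<lambda>k. v (k + m)) at_top sequentially"
    by (rule filterlim_at_top_mono) (use lb in \<open>auto simp: add.commute\<close>)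
  then show ?thesis
    unfolding filterlim_at_top using eventually_sequentially_seg[of "\<lambda>n. Z \<le> v n" m for Z] by blast
qed

end

lemma orbit_le:
  assumes "is_orbit u v" "is_orbit u' v'" "u 0 \<le> u' 0" "v 0 \<le> v' 0"
  shows "u n \<le> u' n \<and> v n \<le> v' n"
proof (induction n)
  case (Suc n)
  then have v: "v (Suc n) \<le> v' (Suc n)" using assms v_Suc by (metis add_mono)
  have "u (Suc n) \<le> u' (Suc n)"
    unfolding u_Suc[OF assms(1)] u_Suc[OF assms(2)]
    using Suc v u_nonneg[OF assms(2)] pos
    by (intro mult_mono Psi_mono) (auto intro: less_imp_le)
  then show ?case using v by simp
qed (use assms in auto)

text \<open>Both coordinates at a fixed time are differentiable in the start. This yields the slope of the
  excess over the critical orbit as well as all continuity statements.\<close>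

lemma seq_differentiable:
  "(\<lambda>u0. u_seq \<Psi> u0 v0 n) field_differentiable at x \<and> (\<lambda>u0. v_seq \<Psi> u0 v0 n) field_differentiable at x"
proof (induction n)
  case (Suc n)
  have "(\<Psi> \<circ> (\<lambda>u0. u_seq \<Psi> u0 v0 n + v_seq \<Psi> u0 v0 n)) field_differentiable at x"
    using Suc C2 by (intro field_differentiable_compose field_differentiable_add)
       (auto simp: C2_real_def)
  then have "(\<lambda>u0. \<Psi> (u_seq \<Psi> u0 v0 n + v_seq \<Psi> u0 v0 n)) field_differentiable at x"
    by (simp add: o_def)
  then show ?case using Suc
    by (auto simp: seq_Suc intro!: field_differentiable_add field_differentiable_mult)
qed (auto simp: field_differentiable_ident field_differentiable_const)

lemma seq_isCont:
  "isCont (\<lambda>u0. u_seq \<Psi> u0 v0 n) x" "isCont (\<lambda>u0. v_seq \<Psi> u0 v0 n) x"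
  using seq_differentiable field_differentiable_imp_continuous_at by blast+

end

section \<open>The critical orbit\<close>

context recursion
begin

lemma critical_curve_0: "critical_curve \<Psi> 0 = 0"
proof -
  have nz: "v_seq \<Psi> 0 0 n = 0 \<and> u_seq \<Psi> 0 0 n = 0" for n
    by (induction n) (auto simp: seq_Suc)
  have "\<not> filterlim (\<lambda>n::nat. 0::real) at_top sequentially"
    by (auto simp: filterlim_at_top intro!: exI[of _ 1])
  then have "\<not> filterlim (v_seq \<Psi> 0 0) at_top sequentially"
    using nz by (simp add: fun_eq_iff[THEN iffD2, of "v_seq \<Psi> 0 0" "\<lambda>_. 0"])
  moreover have "filterlim (v_seq \<Psi> u 0) at_top sequentially" if "0 < u" for u
    using diverges[OF is_orbit_seq[of u 0], of 1] that by (simp add: seq_Suc(1))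
  ultimately have "{u. 0 \<le> u \<and> filterlim (v_seq \<Psi> u 0) at_top sequentially} = {0<..}"
    by (force simp: less_le)
  then show ?thesis unfolding critical_curve_def by simp
qed

text \<open>Escape to infinity is decided at a finite time, as soon as the position is positive, so the
  escaping starting points form an open set and the critical orbit does not escape. If it
  converged to a point below zero, where the steps shrink geometrically, a slightly larger
  starting point would get stuck there as well.\<close>

lemma critical_orbit:
  assumes v: "v < 0"
  defines "h \<equiv> critical_curve \<Psi> v"
  shows "0 < h" "\<And>n. v_seq \<Psi> h v n < 0" "v_seq \<Psi> h v \<longlonglongrightarrow> 0" "u_seq \<Psi> h v \<longlonglongrightarrow> 0"
    and "\<And>u. h < u \<Longrightarrow> filterlim (v_seq \<Psi> u v) at_top sequentially"
proof -
  define S where "S = {u. 0 \<le> u \<and> filterlim (v_seq \<Psi> u v) at_top sequentially}"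
  have h: "h = Inf S" by (simp add: h_def S_def critical_curve_def)
  have bdd: "bdd_below S" by (auto simp: S_def intro: bdd_belowI[of _ 0])
  have SI: "u \<in> S" if "0 < u" "v_seq \<Psi> u v n > 0" for u n
    using diverges[OF is_orbit_seq[of u v], of n] that by (simp add: S_def)
  have ne: "-v + 1 \<in> S" using SI[of "-v+1" 1] v by (simp add: seq_Suc(1))
  have h0: "0 \<le> h" unfolding h by (rule cInf_greatest) (use ne in blast, auto simp: S_def)
  note orb = is_orbit_seq[OF h0, of v]
  show above: "filterlim (v_seq \<Psi> u v) at_top sequentially" if hu: "h < u" for u
  proof -
    obtain s where s: "s \<in> S" "s < u" using hu cInf_lessD[of S u] ne unfolding h by blast
    have "v_seq \<Psi> s v n \<le> v_seq \<Psi> u v n" for n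
      using orbit_le[OF is_orbit_seq[of s v] is_orbit_seq[of u v]] s h0 hu by (auto simp: S_def)
    then show ?thesis using s(1) by (auto simp: S_def intro: filterlim_at_top_mono)
  qed
  have stuck_at_0: "v_seq \<Psi> 0 v n = v \<and> u_seq \<Psi> 0 v n = 0" for n
    by (induction n) (auto simp: seq_Suc)
  have le0: "v_seq \<Psi> h v n \<le> 0" for n
  proof (rule ccontr)
    assume *: "\<not> v_seq \<Psi> h v n \<le> 0"
    then have "0 < h" using stuck_at_0[of n] v h0 by (cases "h = 0") auto
    have "isCont (\<lambda>u. v_seq \<Psi> u v n) h" by (rule seq_isCont)
    then have "((\<lambda>u. v_seq \<Psi> u v n) \<longlongrightarrow> v_seq \<Psi> h v n) (at_left h)"
      unfolding isCont_def by (rule filterlim_mono) (auto simp: at_within_le_at)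
    then have "\<forall>\<^sub>F u in at_left h. 0 < v_seq \<Psi> u v n" by (rule order_tendstoD) (use * in simp)
    moreover have "\<forall>\<^sub>F u in at_left h. u \<in> {0<..<h}" using \<open>0 < h\<close> by (intro eventually_at_leftI) auto
    ultimately have "\<forall>\<^sub>F u in at_left h. False"
    proof eventually_elim
      case (elim u)
      then have "u \<in> S" using SI[of u n] by auto
      then have "h \<le> u" unfolding h using bdd by (rule cInf_lower)
      then show False using elim by simp
    qed
    then show False by simp
  qed
  have "incseq (v_seq \<Psi> h v)" using v_mono[OF orb] by (auto simp: incseq_def)
  then obtain l where l: "v_seq \<Psi> h v \<longlonglongrightarrow> l" "\<And>n. v_seq \<Psi> h v n \<le> l"
    using incseq_convergent[of "v_seq \<Psi> h v" 0] le0 by auto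
  have "(\<lambda>n. v_seq \<Psi> h v (Suc n) - v_seq \<Psi> h v n) \<longlonglongrightarrow> l - l"
    using l(1) by (intro tendsto_diff LIMSEQ_Suc)
  then show u0: "u_seq \<Psi> h v \<longlonglongrightarrow> 0" by (simp add: seq_Suc(1))
  have "l \<le> 0" using LIMSEQ_le_const2[OF l(1)] le0 by blast
  moreover have "\<not> l < 0"
  proof
    assume neg: "l < 0"
    (* As long as the position stays below l/2, the steps shrink by the factor q at least, so
       u / (1 - q) bounds the sum of the steps to come. *)
    define q where "q = \<Psi> (l/2)"
    have q: "0 < q" "q < 1" using lt_1[of "l/2"] neg pos by (auto simp: q_def)
    have "(\<lambda>n. u_seq \<Psi> h v n / (1 - q) + v_seq \<Psi> h v n) \<longlonglongrightarrow> 0 / (1 - q) + l"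
      using u0 l(1) q by (intro tendsto_intros) auto
    then have "\<forall>\<^sub>F n in sequentially. u_seq \<Psi> h v n / (1 - q) + v_seq \<Psi> h v n < l/2"
      using neg by (intro order_tendstoD(2)) auto
    then obtain n where n: "u_seq \<Psi> h v n / (1 - q) + v_seq \<Psi> h v n < l/2"
      by (auto simp: eventually_sequentially)
    have "((\<lambda>u. u_seq \<Psi> u v n / (1 - q) + v_seq \<Psi> u v n) \<longlongrightarrow>
             u_seq \<Psi> h v n / (1 - q) + v_seq \<Psi> h v n) (at h)"
      using seq_isCont[where n=n and x=h and ?v0.0=v] q by (intro tendsto_intros) (auto simp: isCont_def)
    then have "\<forall>\<^sub>F u in at h. u_seq \<Psi> u v n / (1 - q) + v_seq \<Psi> u v n < l/2"
      using n by (rule order_tendstoD)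
    then have "\<forall>\<^sub>F u in at_right h. u_seq \<Psi> u v n / (1 - q) + v_seq \<Psi> u v n < l/2"
      by (rule filter_leD[OF at_le, rotated]) auto
    moreover have "\<forall>\<^sub>F u in at_right h. h < u" by (rule eventually_at_right_less)
    ultimately obtain u where u: "h < u" "u_seq \<Psi> u v n / (1 - q) + v_seq \<Psi> u v n < l/2"
      using eventually_happens[OF eventually_conj] by (metis (lifting) trivial_limit_at_right_real)
    note orbu = is_orbit_seq[of u v]
    have u0: "0 \<le> u" using u h0 by simp
    have trap: "u_seq \<Psi> u v (n+k) / (1 - q) + v_seq \<Psi> u v (n+k) < l/2" for k
    proof (induction k)
      case (Suc k)
      define a b where "a = u_seq \<Psi> u v (n+k)" and "b = v_seq \<Psi> u v (n+k)"
      have a0: "0 \<le> a" unfolding a_def using u_nonneg[OF orbu[OF u0]] .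
      have IH: "a / (1-q) + b < l/2" using Suc by (simp add: a_def b_def)
      have "a \<le> a/(1-q)" using q a0 by (simp add: pos_le_divide_eq mult_left_le)
      then have "a + b \<le> l/2" using IH by linarith
      then have "\<Psi> (a + b) \<le> q" unfolding q_def by (rule Psi_mono)
      then have "a * \<Psi> (a+b) / (1-q) \<le> a * q / (1-q)"
        using q a0 by (intro divide_right_mono mult_left_mono) auto
      moreover have "a * q / (1-q) + (a + b) = a/(1-q) + b" using q by (simp add: field_simps)
      ultimately have "a * \<Psi> (a+b) / (1-q) + (a + b) < l/2" using IH by linarith
      then show ?case by (simp only: add_Suc_right seq_Suc a_def b_def)
    qed (use u in simp)
    have "v_seq \<Psi> u v (n+k) < l/2" for k
      using trap[of k] u_nonneg[OF orbu[OF u0], of "n+k"] q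
      by (meson add_increasing diff_gt_0_iff_gt divide_nonneg_pos leD le_less_linear order_le_less_trans order_refl)
    moreover have "\<forall>\<^sub>F m in sequentially. l/2 \<le> v_seq \<Psi> u v m"
      using above[OF u(1)] unfolding filterlim_at_top by blast
    then obtain M where "\<And>m. m \<ge> M \<Longrightarrow> l/2 \<le> v_seq \<Psi> u v m" by (auto simp: eventually_sequentially)
    then have "l/2 \<le> v_seq \<Psi> u v (n+M)" by simp
    ultimately show False using leD by blast
  qed
  ultimately have "l = 0" by simp
  then show lim: "v_seq \<Psi> h v \<longlonglongrightarrow> 0" using l by simp
  have "h \<noteq> 0"
  proof
    assume "h = 0"
    moreover have "v_seq \<Psi> 0 v = (\<lambda>n. v)" using stuck_at_0 by auto
    ultimately have "(\<lambda>n::nat. v) \<longlonglongrightarrow> 0" using lim by simp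
    then show False using v LIMSEQ_unique tendsto_const by blast
  qed
  then show "0 < h" using h0 by simp
  then show "v_seq \<Psi> h v n < 0" for n
    using u_pos[OF orb, of n] le0[of "Suc n"] by (simp add: seq_Suc(1))
qed

end

section \<open>The free energy after the escape\<close>

context recursion
begin

text \<open>Since \<open>\<Psi> \<le> \<Psi>(\<infinity>)\<close>, the normalised sequence is nonincreasing, so the lower limit is a limit.\<close>

lemma free_energy_tendsto:
  assumes "0 \<le> u0"
  shows "(\<lambda>n. inverse (Psi_inf \<Psi> ^ n) * u_seq \<Psi> u0 v0 n) \<longlonglongrightarrow> free_energy \<Psi> u0 v0"
proof -
  let ?w = "\<lambda>n. inverse (Psi_inf \<Psi> ^ n) * u_seq \<Psi> u0 v0 n"
  note orb = is_orbit_seq[OF assms, of v0]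
  have P: "0 < Psi_inf \<Psi>" using Psi_inf_gt_1 by simp
  have "decseq ?w"
  proof (rule decseq_SucI)
    fix n
    have "u_seq \<Psi> u0 v0 (Suc n) \<le> u_seq \<Psi> u0 v0 n * Psi_inf \<Psi>"
      unfolding u_Suc[OF orb] using u_nonneg[OF orb] le_Psi_inf by (intro mult_left_mono)
    then show "?w (Suc n) \<le> ?w n" using P by (simp add: field_simps)
  qed
  moreover have "\<forall>n. 0 \<le> ?w n" using u_nonneg[OF orb] P by simp
  ultimately obtain L where L: "?w \<longlonglongrightarrow> L" using decseq_convergent[of ?w 0] by metis
  then have "liminf (\<lambda>n. ereal (?w n)) = ereal L"
    by (intro lim_imp_Liminf) auto
  then have "free_energy \<Psi> u0 v0 = L" by (simp add: free_energy_def)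
  then show ?thesis using L by simp
qed

text \<open>From a position bounded away from zero on, the position grows geometrically at a rate
  \<open>\<kappa> > 1\<close>, so the deficits \<open>\<Psi>(\<infinity>) - \<Psi>(v\<^sub>n)\<close> are dominated by the summable sequence
  \<open>\<Psi>(\<infinity>) - \<Psi>(\<kappa>\<^sup>n)\<close>: up to a bounded factor the free energy is \<open>\<Psi>(\<infinity>)\<close> to the power minus the
  time \<open>N\<close> of arrival at this position. The bound is uniform in the orbit.\<close>

lemma free_energy_after_escape:
  assumes \<eta>: "0 < \<eta>" and a: "0 < a"
  obtains S where "\<And>u0 v0 N. 0 \<le> u0 \<Longrightarrow> \<eta> \<le> v_seq \<Psi> u0 v0 N \<Longrightarrow> a \<le> u_seq \<Psi> u0 v0 N \<Longrightarrow>
    exp (-S) * u_seq \<Psi> u0 v0 N \<le> free_energy \<Psi> u0 v0 * Psi_inf \<Psi> ^ N \<and>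
    free_energy \<Psi> u0 v0 * Psi_inf \<Psi> ^ N \<le> u_seq \<Psi> u0 v0 N"
proof -
  define P where "P = Psi_inf \<Psi>"
  have P1: "1 < P" using Psi_inf_gt_1 by (simp add: P_def)
  define \<kappa> where "\<kappa> = sqrt (\<Psi> \<eta>)"
  have \<kappa>: "1 < \<kappa>" and \<kappa>2: "\<kappa> * \<kappa> = \<Psi> \<eta>" using gt_1[OF \<eta>] by (auto simp: \<kappa>_def)
  (* From index k0 on, the lower bound a * \<kappa> ^ (2 * k) for the steps is at least \<kappa> ^ (k + 1). *)
  obtain k0 where k0: "\<kappa> / a < \<kappa> ^ k0" using real_arch_pow[OF \<kappa>] by blast
  define s where "s = (\<lambda>k. P - \<Psi> (\<kappa> ^ Suc k))"
  (* The first k0 factors are only bounded by \<Psi> \<ge> 1. *)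
  define t where "t = (\<lambda>k. s k + (if k < k0 then ln P else 0))"
  have s0: "0 \<le> s k" for k using le_Psi_inf by (simp add: s_def P_def)
  then have t0: "0 \<le> t k" for k using P1 by (simp add: t_def)
  have sums: "summable t"
    unfolding t_def s_def P_def using summable_deficit[OF \<kappa>]
    by (intro summable_add summable_If_finite) auto
  define S where "S = suminf t"
  have "exp (-S) * u_seq \<Psi> u0 v0 N \<le> free_energy \<Psi> u0 v0 * P ^ N \<and>
    free_energy \<Psi> u0 v0 * P ^ N \<le> u_seq \<Psi> u0 v0 N"
    if u0: "0 \<le> u0" and vN: "\<eta> \<le> v_seq \<Psi> u0 v0 N" and uN: "a \<le> u_seq \<Psi> u0 v0 N" for u0 v0 N
  proof -
    define u v where "u = u_seq \<Psi> u0 v0" and "v = v_seq \<Psi> u0 v0"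
    have orb: "is_orbit u v" using is_orbit_seq[OF u0] by (simp add: u_def v_def)
    note [simp] = u_nonneg[OF orb]
    have v_ge: "\<eta> \<le> v (N + k)" for k using v_mono[OF orb, of N "N+k"] vN by (simp add: v_def)
    have u_ge: "a * (\<kappa>^k * \<kappa>^k) \<le> u (N + k)" for k
    proof (induction k)
      case (Suc k)
      have "a * (\<kappa>^k * \<kappa>^k) * \<Psi> \<eta> \<le> u (N+k) * \<Psi> (v (N + Suc k))"
        using Suc a pos v_ge[of "Suc k"] \<kappa> by (intro mult_mono Psi_mono) (auto intro: less_imp_le)
      then show ?case using u_Suc[OF orb, of "N+k"] by (simp add: \<kappa>2[symmetric] algebra_simps)
    qed (use uN in \<open>simp add: u_def\<close>)
    have v_far: "\<kappa> ^ Suc k \<le> v (N + Suc k)" if "k0 \<le> k" for k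
    proof -
      have "\<kappa> / a \<le> \<kappa> ^ k" using k0 that \<kappa> by (meson less_imp_le order_trans power_increasing less_le_trans)
      then have "\<kappa> \<le> a * \<kappa>^k" using a by (simp add: field_simps)
      then have "\<kappa> * \<kappa>^k \<le> a * \<kappa>^k * \<kappa>^k" using \<kappa> by (intro mult_right_mono) auto
      also have "\<dots> \<le> u (N+k)" using u_ge[of k] by (simp add: mult.assoc)
      also have "\<dots> \<le> v (N + Suc k)" using v_Suc[OF orb, of "N+k"] v_ge[of k] \<eta> by simp
      finally show ?thesis by simp
    qed
    have factor: "P * exp (- t k) \<le> \<Psi> (v (N + Suc k))" for k
    proof -
      define y where "y = \<Psi> (v (N + Suc k))"
      have y1: "1 \<le> y" unfolding y_def using v_ge[of "Suc k"] \<eta> by (intro ge_1) simp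
      have "P \<le> y * exp (t k)"
      proof (cases "k < k0")
        case True
        have "P \<le> exp (t k)" using True s0[of k] P1 by (simp add: t_def exp_add mult_le_cancel_right1)
        also have "\<dots> \<le> y * exp (t k)" using y1 by simp
        finally show ?thesis .
      next
        case False
        have "\<Psi> (\<kappa> ^ Suc k) \<le> y" unfolding y_def using v_far[of k] False by (intro Psi_mono) simp
        then have "P \<le> y + t k" using False by (simp add: t_def s_def)
        also have "\<dots> \<le> y + y * t k" using y1 t0[of k] by (simp add: mult_le_cancel_right1)
        also have "\<dots> = y * (1 + t k)" by (simp add: algebra_simps)
        also have "\<dots> \<le> y * exp (t k)" using y1 by (intro mult_left_mono exp_ge_add_one_self) auto
        finally show ?thesis .
      qed
      then have "P * exp (- t k) \<le> y * exp (t k) * exp (- t k)" by (intro mult_right_mono) auto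
      then show ?thesis by (simp add: y_def mult.assoc flip: exp_add)
    qed
    have growth: "u N * P^k * exp (- sum t {..<k}) \<le> u (N+k) \<and> u (N+k) \<le> u N * P^k" for k
    proof (induction k)
      case (Suc k)
      have eq: "u (N + Suc k) = u (N+k) * \<Psi> (v (N + Suc k))" using u_Suc[OF orb, of "N+k"] by simp
      have "u N * P^k * exp (- sum t {..<k}) * (P * exp (- t k)) \<le> u (N + Suc k)"
        unfolding eq using Suc factor[of k] P1 by (intro mult_mono) auto
      moreover have "u (N + Suc k) \<le> u N * P^k * P"
        unfolding eq using Suc le_Psi_inf pos P1
        by (intro mult_mono) (auto simp: P_def intro: less_imp_le)
      ultimately show ?case by (simp add: exp_diff exp_minus field_simps)
    qed simp
    let ?w = "\<lambda>n. inverse (P ^ n) * u n"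
    have lim: "(\<lambda>k. ?w (N + k) * P^N) \<longlonglongrightarrow> free_energy \<Psi> u0 v0 * P ^ N"
      using LIMSEQ_ignore_initial_segment[OF free_energy_tendsto[OF u0, of v0], of N]
      by (intro tendsto_mult_right) (simp add: u_def P_def add.commute)
    have w: "?w (N + k) * P^N = u (N+k) / P^k" for k
      using P1 by (simp add: power_add field_simps)
    have "exp (-S) * u N \<le> ?w (N+k) * P^N" for k
    proof -
      have "sum t {..<k} \<le> S" unfolding S_def by (rule sum_le_suminf[OF sums]) (use t0 in auto)
      then have "u N * exp (-S) \<le> u N * exp (- sum t {..<k})" by (intro mult_left_mono) auto
      also have "\<dots> = u N * P^k * exp (- sum t {..<k}) / P^k" using P1 by simp
      also have "\<dots> \<le> u (N+k) / P^k" using growth[of k] P1 by (intro divide_right_mono) auto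
      finally show ?thesis unfolding w by (simp add: mult.commute)
    qed
    moreover have "?w (N+k) * P^N \<le> u N" for k
      unfolding w using growth[of k] P1 by (simp add: divide_le_eq)
    ultimately show ?thesis
      using LIMSEQ_le_const[OF lim] LIMSEQ_le_const2[OF lim] unfolding u_def by blast
  qed
  then show ?thesis using that[of S] by (auto simp: P_def)
qed

end

section \<open>Potential and energy gain near the origin\<close>

text \<open>\<open>G\<close> is the potential of the differential equation \<open>du/dv = \<Psi>(v) - 1\<close>, of which the recursion is a
discretisation. On \<open>[-r, r]\<close> the map \<open>\<Psi>\<close> is \<open>1 + v\<close> up to an error controlled by \<open>K\<close>; the
smallness of \<open>K * r\<close> leaves room for every numerical constant that occurs later.\<close>

locale local_regime = recursion +
  fixes G :: "real \<Rightarrow> real" and K r :: real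
  assumes G_deriv: "\<And>x. (G has_real_derivative \<Psi> x - 1) (at x)"
    and G_0: "G 0 = 0"
    and K_ge_1: "1 \<le> K" and r_pos: "0 < r" and Kr: "K * r \<le> 1/1000"
    and second_deriv_le: "\<And>x. \<bar>x\<bar> \<le> r \<Longrightarrow> \<bar>deriv (deriv \<Psi>) x\<bar> \<le> K"

lemma (in recursion) local_regime_exists: "\<exists>G K r. local_regime \<Psi> G K r"
proof -
  have "isCont (\<lambda>x. \<Psi> x - 1) x" for x by (intro continuous_intros isCont)
  then obtain G0 where G0: "\<And>x. (G0 has_vector_derivative (\<Psi> x - 1)) (at x)"
    using einterval_antiderivative[of "-\<infinity>" "\<infinity>" "\<lambda>x. \<Psi> x - 1"] by auto
  define G where "G x = G0 x - G0 0" for x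
  have G: "(G has_real_derivative \<Psi> x - 1) (at x)" for x
    unfolding G_def using G0[of x]
    by (auto simp: has_real_derivative_iff_has_vector_derivative intro!: derivative_eq_intros)
  have "compact (deriv (deriv \<Psi>) ` {-1..1})"
    using C2 by (intro compact_continuous_image) (auto simp: C2_real_def intro: continuous_on_subset)
  then have "bounded (deriv (deriv \<Psi>) ` {-1..1})" by (rule compact_imp_bounded)
  then obtain B where B: "\<forall>x\<in>{-1..1}. \<bar>deriv (deriv \<Psi>) x\<bar> \<le> B"
    by (auto simp: bounded_iff)
  define K where "K = max 1 B"
  have "local_regime \<Psi> G K (1 / (1000 * K))"
  proof unfold_locales
    fix x :: real assume "\<bar>x\<bar> \<le> 1 / (1000 * K)"
    also have "\<dots> \<le> 1" by (simp add: K_def field_simps)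
    finally show "\<bar>deriv (deriv \<Psi>) x\<bar> \<le> K" using bspec[OF B, of x] by (simp add: K_def le_max_iff_disj abs_le_iff)
  qed (use G in \<open>auto simp: G_def K_def\<close>)
  then show ?thesis by blast
qed

context local_regime
begin

lemma r_le: "r \<le> 1/1000"
  using K_ge_1 r_pos Kr mult_right_mono[of 1 K r] by linarith

lemma deriv_near_1: "\<bar>x\<bar> \<le> r \<Longrightarrow> \<bar>deriv \<Psi> x - 1\<bar> \<le> K * \<bar>x\<bar>"
  by (rule bound_from_deriv[of "\<lambda>x. deriv \<Psi> x - 1" _ "deriv (deriv \<Psi>)"])
     (auto simp: deriv_at_0 intro!: derivative_eq_intros has_deriv2 second_deriv_le)

lemma Psi_taylor: assumes "\<bar>x\<bar> \<le> r" shows "\<bar>\<Psi> x - 1 - x\<bar> \<le> K * x\<^sup>2"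
proof -
  have "\<bar>\<Psi> x - 1 - x\<bar> \<le> (K * \<bar>x\<bar>) * \<bar>x\<bar>"
  proof (rule bound_from_deriv[of "\<lambda>x. \<Psi> x - 1 - x" _ "\<lambda>x. deriv \<Psi> x - 1"])
    fix t :: real assume t: "\<bar>t\<bar> \<le> \<bar>x\<bar>"
    then have "\<bar>deriv \<Psi> t - 1\<bar> \<le> K * \<bar>t\<bar>" using assms by (intro deriv_near_1) simp
    also have "\<dots> \<le> K * \<bar>x\<bar>" using t K_ge_1 by (intro mult_left_mono) auto
    finally show "\<bar>deriv \<Psi> t - 1\<bar> \<le> K * \<bar>x\<bar>" .
  qed (auto simp: at_0 intro!: derivative_eq_intros has_deriv)
  then show ?thesis by (simp add: power2_eq_square mult.assoc)
qed

lemma G_taylor: assumes "\<bar>x\<bar> \<le> r" shows "\<bar>G x - x\<^sup>2 / 2\<bar> \<le> K * \<bar>x\<bar> * x\<^sup>2"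
proof -
  have "\<bar>G x - x\<^sup>2 / 2\<bar> \<le> (K * x\<^sup>2) * \<bar>x\<bar>"
  proof (rule bound_from_deriv[of "\<lambda>x. G x - x\<^sup>2 / 2" _ "\<lambda>x. \<Psi> x - 1 - x"])
    fix t :: real assume t: "\<bar>t\<bar> \<le> \<bar>x\<bar>"
    then have "\<bar>\<Psi> t - 1 - t\<bar> \<le> K * t\<^sup>2" using assms by (intro Psi_taylor) simp
    also have "\<dots> \<le> K * x\<^sup>2" using t K_ge_1 by (intro mult_left_mono) (auto simp: abs_le_square_iff)
    finally show "\<bar>\<Psi> t - 1 - t\<bar> \<le> K * x\<^sup>2" .
    show "((\<lambda>x. G x - x\<^sup>2 / 2) has_real_derivative \<Psi> t - 1 - t) (at t)"
      by (auto intro!: derivative_eq_intros G_deriv)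
  qed (simp add: G_0)
  then show ?thesis by (simp add: mult_ac)
qed

lemma K_small: "\<bar>x\<bar> \<le> r \<Longrightarrow> K * \<bar>x\<bar> \<le> 1/1000"
  using mult_left_mono[of "\<bar>x\<bar>" r K] K_ge_1 Kr by linarith

lemma deriv_le: assumes "\<bar>x\<bar> \<le> r" shows "\<bar>deriv \<Psi> x\<bar> \<le> 5/4"
  using deriv_near_1[OF assms] K_small[OF assms] by linarith

lemma G_le: assumes "\<bar>x\<bar> \<le> r" shows "G x \<le> x\<^sup>2"
proof -
  have "K * \<bar>x\<bar> * x\<^sup>2 \<le> 1/1000 * x\<^sup>2" using K_small[OF assms] by (intro mult_right_mono) auto
  then show ?thesis using G_taylor[OF assms] zero_le_power2[of x] by linarith
qed

text \<open>On the negative side the drop of the potential dominates the drop of \<open>v\<^sup>2\<close>, not only the square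
of the distance. This is what makes the excess of an orbit over the critical one control the
product of distance and position.\<close>

lemma G_diff_ge:
  assumes "-r \<le> x" "x \<le> y" "y \<le> 0"
  shows "3/8 * (x\<^sup>2 - y\<^sup>2) \<le> G x - G y"
proof -
  have "G y - 3/8 * y\<^sup>2 \<le> G x - 3/8 * x\<^sup>2"
  proof (rule DERIV_nonpos_imp_nonincreasing[OF assms(2), of "\<lambda>x. G x - 3/8 * x\<^sup>2"])
    fix t assume t: "x \<le> t" "t \<le> y"
    then have "\<bar>t\<bar> \<le> r" using assms by auto
    note * = Psi_taylor[OF this] K_small[OF this]
    have "K * \<bar>t\<bar> * \<bar>t\<bar> \<le> 1/1000 * \<bar>t\<bar>" using * by (intro mult_right_mono) auto
    then have "\<Psi> t - 1 - 3/4 * t \<le> 0" using * t assms by (auto simp: power2_eq_square abs_le_iff mult.assoc)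
    moreover have "((\<lambda>x. G x - 3/8 * x\<^sup>2) has_real_derivative \<Psi> t - 1 - 3/4 * t) (at t)"
      by (auto intro!: derivative_eq_intros G_deriv)
    ultimately show "\<exists>z. ((\<lambda>x. G x - 3/8 * x\<^sup>2) has_real_derivative z) (at t) \<and> z \<le> 0" by blast
  qed
  then show ?thesis by (simp add: algebra_simps)
qed

text \<open>The change of the energy \<open>u - G(v)\<close> in one step, that is, the error of the right end point rule for
the integral of \<open>\<Psi> - 1\<close> over the step.\<close>

definition gain :: "real \<Rightarrow> real \<Rightarrow> real" where
  "gain u v = u * (\<Psi> (u + v) - 1) - (G (u + v) - G v)"

lemma gain_nonneg: assumes "0 \<le> u" shows "0 \<le> gain u v"
proof -
  have "(\<lambda>x. G x - x * (\<Psi> (u+v) - 1)) (u+v) \<le> (\<lambda>x. G x - x * (\<Psi> (u+v) - 1)) v"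
  proof (rule DERIV_nonpos_imp_nonincreasing[of v "u + v" "\<lambda>x. G x - x * (\<Psi> (u+v) - 1)"])
    fix x assume "v \<le> x" "x \<le> u + v"
    then have "(\<Psi> x - 1) - (\<Psi> (u+v) - 1) \<le> 0" using Psi_mono[of x "u+v"] by simp
    moreover have "((\<lambda>x. G x - x * (\<Psi> (u+v) - 1)) has_real_derivative (\<Psi> x - 1) - (\<Psi> (u+v) - 1)) (at x)"
      by (auto intro!: derivative_eq_intros G_deriv)
    ultimately show "\<exists>z. ((\<lambda>x. G x - x * (\<Psi> (u+v) - 1)) has_real_derivative z) (at x) \<and> z \<le> 0" by blast
  qed (use assms in simp)
  then show ?thesis by (simp add: gain_def algebra_simps)
qed

text \<open>The derivative of the gain in \<open>u\<close> is \<open>u * \<Psi>'(u + v)\<close>: the other two terms cancel.\<close>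

lemma gain_diff_u:
  assumes "0 \<le> s" "s \<le> u" "-r \<le> v" "u + v \<le> r"
  shows "\<bar>gain u v - gain s v\<bar> \<le> 2 * u * (u - s)"
proof -
  have "norm (gain u v - gain s v) \<le> (u * (5/4)) * norm (u - s)"
  proof (rule field_differentiable_bound[of "{s..u}" "\<lambda>u. gain u v" "\<lambda>x. x * deriv \<Psi> (x + v)"])
    fix x assume x: "x \<in> {s..u}"
    have "((\<lambda>u. \<Psi> (u + v)) has_real_derivative deriv \<Psi> (x + v)) (at x)"
      using DERIV_shift has_deriv by blast
    moreover have "((\<lambda>u. G (u + v)) has_real_derivative \<Psi> (x + v) - 1) (at x)"
      using DERIV_shift G_deriv by blast
    ultimately have "((\<lambda>u. gain u v) has_real_derivative x * deriv \<Psi> (x + v)) (at x)"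
      unfolding gain_def by (auto intro!: derivative_eq_intros)
    then show "((\<lambda>u. gain u v) has_real_derivative x * deriv \<Psi> (x + v)) (at x within {s..u})"
      by (rule has_field_derivative_at_within)
    have "\<bar>x\<bar> * \<bar>deriv \<Psi> (x + v)\<bar> \<le> u * (5/4)"
      using x assms deriv_le[of "x+v"] by (intro mult_mono) auto
    then show "norm (x * deriv \<Psi> (x + v)) \<le> u * (5/4)" by (simp add: abs_mult)
  qed (use assms in auto)
  also have "norm (u - s) = u - s" using assms by simp
  also have "u * (5/4) * (u - s) \<le> 2 * u * (u - s)"
    using assms by (intro mult_right_mono) auto
  finally show ?thesis by simp
qed

text \<open>The derivative of the gain in \<open>v\<close> is a first order Taylor remainder of \<open>\<Psi>\<close> over a step of
length \<open>u\<close>, hence quadratic in \<open>u\<close>. The bound on the second derivative enters here directly.\<close>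

lemma gain_diff_v:
  assumes "0 \<le> u" "-r \<le> w" "w \<le> v" "u + v \<le> r"
  shows "\<bar>gain u v - gain u w\<bar> \<le> K * u\<^sup>2 * (v - w)"
proof -
  have "norm (gain u v - gain u w) \<le> (K * u\<^sup>2) * norm (v - w)"
  proof (rule field_differentiable_bound[of "{w..v}" "\<lambda>v. gain u v"
        "\<lambda>x. u * deriv \<Psi> (u + x) - (\<Psi> (u + x) - \<Psi> x)"])
    fix x assume x: "x \<in> {w..v}"
    have "((\<lambda>v. \<Psi> (u + v)) has_real_derivative deriv \<Psi> (u + x)) (at x)"
      using DERIV_shift[of \<Psi> "deriv \<Psi> (u + x)" x u] has_deriv[of "u + x"] by (simp add: add.commute)
    moreover have "((\<lambda>v. G (u + v)) has_real_derivative \<Psi> (u + x) - 1) (at x)"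
      using DERIV_shift[of G "\<Psi> (u + x) - 1" x u] G_deriv[of "u + x"] by (simp add: add.commute)
    ultimately have "((\<lambda>v. gain u v) has_real_derivative u * deriv \<Psi> (u + x) - (\<Psi> (u + x) - \<Psi> x)) (at x)"
      unfolding gain_def by (auto intro!: derivative_eq_intros G_deriv)
    then show "((\<lambda>v. gain u v) has_real_derivative u * deriv \<Psi> (u + x) - (\<Psi> (u + x) - \<Psi> x)) (at x within {w..v})"
      by (rule has_field_derivative_at_within)
    have "norm ((\<Psi> (u + x) - (u + x) * deriv \<Psi> (u + x)) - (\<Psi> x - x * deriv \<Psi> (u + x)))
        \<le> (K * u) * norm (u + x - x)"
    proof (rule field_differentiable_bound[of "{x..u+x}" "\<lambda>y. \<Psi> y - y * deriv \<Psi> (u + x)"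
          "\<lambda>y. deriv \<Psi> y - deriv \<Psi> (u + x)"])
      fix y assume y: "y \<in> {x..u+x}"
      show "((\<lambda>y. \<Psi> y - y * deriv \<Psi> (u + x)) has_real_derivative deriv \<Psi> y - deriv \<Psi> (u + x))
          (at y within {x..u+x})"
        by (rule has_field_derivative_at_within) (auto intro!: derivative_eq_intros has_deriv)
      have "norm (deriv \<Psi> y - deriv \<Psi> (u + x)) \<le> K * norm (y - (u + x))"
        by (rule field_differentiable_bound[of "{x..u+x}" "deriv \<Psi>" "deriv (deriv \<Psi>)"])
           (use x y assms in \<open>auto intro!: has_field_derivative_at_within[OF has_deriv2] second_deriv_le\<close>)
      also have "\<dots> \<le> K * u" using y K_ge_1 by (intro mult_left_mono) auto
      finally show "norm (deriv \<Psi> y - deriv \<Psi> (u + x)) \<le> K * u" .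
    qed (use assms in auto)
    then show "norm (u * deriv \<Psi> (u + x) - (\<Psi> (u + x) - \<Psi> x)) \<le> K * u\<^sup>2"
      using assms by (simp add: abs_minus_commute power2_eq_square algebra_simps)
  qed (use assms in auto)
  then show ?thesis using assms by simp
qed

lemma gain_le: assumes "0 \<le> u" "-r \<le> v" "u + v \<le> r" shows "gain u v \<le> 2 * u\<^sup>2"
  using gain_diff_u[of 0 u v] assms by (simp add: gain_def power2_eq_square)

end

section \<open>Energy along orbits\<close>

context local_regime
begin

definition energy :: "(nat \<Rightarrow> real) \<Rightarrow> (nat \<Rightarrow> real) \<Rightarrow> nat \<Rightarrow> real" where
  "energy u v n = u n - G (v n)"

lemma energy_Suc: "is_orbit u v \<Longrightarrow> energy u v (Suc n) = energy u v n + gain (u n) (v n)"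
  by (simp add: energy_def gain_def u_Suc v_Suc algebra_simps)

lemma energy_mono: assumes "is_orbit u v" "n \<le> m" shows "energy u v n \<le> energy u v m"
  using assms(2)
  by (rule lift_Suc_mono_le[of "energy u v", rotated])
     (simp add: energy_Suc[OF assms(1)] gain_nonneg u_nonneg[OF assms(1)])

text \<open>The gains are quadratic in the steps, and the steps add up to the distance travelled.\<close>

lemma energy_increase:
  assumes orb: "is_orbit u v" and nm: "n \<le> m" and v: "-r \<le> v n" "v m \<le> r"
    and B: "\<And>k. n \<le> k \<Longrightarrow> k < m \<Longrightarrow> u k \<le> B"
  shows "energy u v m - energy u v n \<le> 2 * B * (v m - v n)"
  using nm v(2) B
proof (induction m rule: dec_induct)
  case (step m)
  have vm: "-r \<le> v m" using v_mono[OF orb step(1)] v by simp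
  have "v m \<le> r" using v_mono[OF orb, of m "Suc m"] step by simp
  then have IH: "energy u v m - energy u v n \<le> 2 * B * (v m - v n)" using step by simp
  have "gain (u m) (v m) \<le> 2 * (u m)\<^sup>2"
    using gain_le[OF u_nonneg[OF orb] vm] step v_Suc[OF orb, of m] by simp
  also have "\<dots> \<le> 2 * B * u m"
    using step.prems(2)[of m] step.hyps u_nonneg[OF orb, of m] by (simp add: power2_eq_square mult_right_mono)
  finally show ?case using IH energy_Suc[OF orb, of m] v_Suc[OF orb, of m] by (simp add: algebra_simps)
qed simp

text \<open>The energy of an orbit \<open>(u, v)\<close> relative to an orbit \<open>(a, b)\<close> that starts below it and will be
the critical one.\<close>

definition excess :: "(nat \<Rightarrow> real) \<Rightarrow> (nat \<Rightarrow> real) \<Rightarrow> (nat \<Rightarrow> real) \<Rightarrow> (nat \<Rightarrow> real) \<Rightarrow> nat \<Rightarrow> real" where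
  "excess u v a b n = energy u v n - energy a b n"

context
  fixes u v a b :: "nat \<Rightarrow> real"
  assumes orb: "is_orbit u v" and orb': "is_orbit a b" and start: "a 0 \<le> u 0" "b 0 \<le> v 0"
begin

lemma u_ge: "a n \<le> u n" and v_ge: "b n \<le> v n"
  using orbit_le[OF orb' orb start] by auto

text \<open>To the left of \<open>0\<close> the potential decreases, so both the gap in the steps and the gap in the squared
positions contribute nonnegatively to the excess.\<close>

lemma excess_ge:
  assumes "-r \<le> b n" "v n \<le> 0"
  shows "u n - a n \<le> excess u v a b n" "3/8 * ((b n)\<^sup>2 - (v n)\<^sup>2) \<le> excess u v a b n"
proof -
  have *: "3/8 * ((b n)\<^sup>2 - (v n)\<^sup>2) \<le> G (b n) - G (v n)"
    using G_diff_ge[of "b n" "v n"] assms v_ge by simp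
  have "(v n)\<^sup>2 \<le> (b n)\<^sup>2" using v_ge[of n] assms by (simp add: abs_le_square_iff[symmetric])
  then have "0 \<le> 3/8 * ((b n)\<^sup>2 - (v n)\<^sup>2)" by simp
  then show "u n - a n \<le> excess u v a b n" "3/8 * ((b n)\<^sup>2 - (v n)\<^sup>2) \<le> excess u v a b n"
    using * u_ge[of n] unfolding excess_def energy_def by linarith+
qed

lemma excess_nonneg: "-r \<le> b n \<Longrightarrow> v n \<le> 0 \<Longrightarrow> 0 \<le> excess u v a b n"
  using excess_ge(1) u_ge by (meson diff_ge_0_iff_ge order_trans)

text \<open>The key estimate: the change of the excess is bounded by the excess itself times the step.
By the Lipschitz bounds on the gain it is at most \<open>2 u (u - a) + K a\<^sup>2 (v - b)\<close>. The first gap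
is bounded by the excess. In the second term \<open>a \<le> u \<le> \<bar>v\<bar> \<le> \<bar>b\<bar>\<close>, because the orbit has not yet
crossed \<open>0\<close>, and \<open>\<bar>b\<bar> (v - b)\<close> is again bounded by a multiple of the excess.\<close>

lemma excess_step:
  assumes b: "-r \<le> b n" and v: "v (Suc n) \<le> 0"
  shows "\<bar>excess u v a b (Suc n) - excess u v a b n\<bar> \<le> 5 * K * u n * excess u v a b n"
proof -
  have un: "0 \<le> u n" "0 \<le> a n" using u_nonneg orb orb' by auto
  have uv: "u n + v n \<le> 0" using v v_Suc[OF orb] by simp
  note e = excess_ge[OF b] excess_nonneg[OF b]
  have vn: "v n \<le> 0" using uv un by simp
  have "excess u v a b (Suc n) - excess u v a b n =
      (gain (u n) (v n) - gain (a n) (v n)) + (gain (a n) (v n) - gain (a n) (b n))"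
    using energy_Suc[OF orb, of n] energy_Suc[OF orb', of n] by (simp add: excess_def)
  moreover have "\<bar>gain (u n) (v n) - gain (a n) (v n)\<bar> \<le> 2 * u n * (u n - a n)"
    using un u_ge[of n] v_ge[of n] b uv r_pos by (intro gain_diff_u) auto
  moreover have "2 * u n * (u n - a n) \<le> 2 * u n * excess u v a b n"
    using un e(1) vn by (intro mult_left_mono) auto
  moreover have "\<bar>gain (a n) (v n) - gain (a n) (b n)\<bar> \<le> K * (a n)\<^sup>2 * (v n - b n)"
    using un u_ge[of n] v_ge[of n] b uv r_pos by (intro gain_diff_v) auto
  moreover have "K * (a n)\<^sup>2 * (v n - b n) \<le> K * (8/3 * (u n * excess u v a b n))"
  proof -
    have "(a n)\<^sup>2 * (v n - b n) \<le> u n * (- b n) * (v n - b n)"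
      unfolding power2_eq_square using un u_ge[of n] v_ge[of n] uv
      by (intro mult_right_mono mult_mono) auto
    also have "\<dots> = u n * ((- b n) * (v n - b n))" by simp
    also have "\<dots> \<le> u n * ((b n)\<^sup>2 - (v n)\<^sup>2)"
    proof (intro mult_left_mono un)
      have "0 \<le> (- v n) * (v n - b n)" using v_ge[of n] vn by (intro mult_nonneg_nonneg) auto
      then show "(- b n) * (v n - b n) \<le> (b n)\<^sup>2 - (v n)\<^sup>2"
        by (simp add: power2_eq_square algebra_simps)
    qed
    also have "\<dots> \<le> u n * (8/3 * excess u v a b n)"
      using e(2) vn by (intro mult_left_mono un) simp
    finally show ?thesis
      using K_ge_1 mult_left_mono[of "(a n)\<^sup>2 * (v n - b n)" "u n * (8/3 * excess u v a b n)" K]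
      by (simp add: mult_ac)
  qed
  moreover have "2 * u n * excess u v a b n + K * (8/3 * (u n * excess u v a b n)) \<le> 5 * K * u n * excess u v a b n"
  proof -
    have "0 \<le> (7/3 * K - 2) * (u n * excess u v a b n)" using un e(3) vn K_ge_1 by simp
    then show ?thesis by (simp add: algebra_simps)
  qed
  ultimately show ?thesis by linarith
qed

text \<open>The steps sum to the distance travelled, so up to the crossing of \<open>0\<close> the excess is preserved up
to a factor that tends to one as the starting position tends to \<open>0\<close>, uniformly in the orbit.\<close>

lemma excess_ratio:
  assumes "n \<le> m" and b: "-r \<le> b n" and vm: "v m \<le> 0"
  shows "excess u v a b n * exp (- 10 * K * (v m - v n)) \<le> excess u v a b m"
    and "excess u v a b m \<le> excess u v a b n * exp (5 * K * (v m - v n))"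
proof -
  have "excess u v a b n * exp (- 10 * K * (v m - v n)) \<le> excess u v a b m \<and>
        excess u v a b m \<le> excess u v a b n * exp (5 * K * (v m - v n))"
    using assms(1) vm
  proof (induction m rule: dec_induct)
    case (step m)
    have um: "0 \<le> u m" by (rule u_nonneg[OF orb])
    have vs: "v (Suc m) = u m + v m" by (rule v_Suc[OF orb])
    have vm: "v m \<le> 0" using vs um step.prems by simp
    have bm: "-r \<le> b m" using v_mono[OF orb' step.hyps(1)] b by simp
    define x where "x = 5 * K * u m"
    have "K * u m \<le> K * r" using vs step.prems bm v_ge[of m] K_ge_1 by (intro mult_left_mono) auto
    moreover have "0 \<le> K * u m" using um K_ge_1 by simp
    ultimately have x: "0 \<le> x" "x \<le> 1/2" using Kr unfolding x_def by linarith+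
    have e0: "0 \<le> excess u v a b m" by (rule excess_nonneg[OF bm vm])
    have st: "\<bar>excess u v a b (Suc m) - excess u v a b m\<bar> \<le> x * excess u v a b m"
      using excess_step[OF bm step.prems] by (simp add: x_def)
    have "excess u v a b n * exp (- 10 * K * (v (Suc m) - v n)) = 
          excess u v a b n * exp (- 10 * K * (v m - v n)) * exp (-2 * x)"
      by (simp add: vs x_def algebra_simps flip: exp_add)
    also have "\<dots> \<le> excess u v a b m * (1 - x)"
      using step.IH[OF vm] exp_minus_double_le[OF x] e0 by (intro mult_mono) auto
    also have "\<dots> \<le> excess u v a b (Suc m)" using st by (simp add: algebra_simps)
    finally have 1: "excess u v a b n * exp (- 10 * K * (v (Suc m) - v n)) \<le> excess u v a b (Suc m)" .
    have "excess u v a b (Suc m) \<le> excess u v a b m * (1 + x)" using st by (simp add: algebra_simps)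
    also have "\<dots> \<le> excess u v a b n * exp (5 * K * (v m - v n)) * exp x"
      using step.IH[OF vm] e0 x exp_ge_add_one_self[of x] by (intro mult_mono) auto
    also have "\<dots> = excess u v a b n * exp (5 * K * (v (Suc m) - v n))"
      by (simp add: vs x_def algebra_simps flip: exp_add)
    finally show ?case using 1 by simp
  qed simp
  then show "excess u v a b n * exp (- 10 * K * (v m - v n)) \<le> excess u v a b m"
    and "excess u v a b m \<le> excess u v a b n * exp (5 * K * (v m - v n))" by auto
qed

end

text \<open>The energy increases to its limit \<open>0\<close> along the critical orbit, so it is nonpositive, whence,
once the orbit is in \<open>[-r, 0]\<close>, \<open>a \<le> G(b) \<le> b\<^sup>2\<close>. The gains still to come are quadratic in the remaining steps, which are at most
\<open>b\<^sup>2\<close> and sum to \<open>\<bar>b\<bar>\<close>: the energy is only of third order.\<close>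

lemma critical_energy:
  assumes orb: "is_orbit a b" and a: "a \<longlonglongrightarrow> 0" and b: "b \<longlonglongrightarrow> 0" and b0: "\<And>n. b n \<le> 0"
  shows "energy a b n \<le> 0" and "-r \<le> b n \<Longrightarrow> - 2 * \<bar>b n\<bar> * (b n)\<^sup>2 \<le> energy a b n"
proof -
  have "isCont G 0" using G_deriv DERIV_isCont by blast
  then have "(\<lambda>n. G (b n)) \<longlonglongrightarrow> G 0" using b by (rule isCont_tendsto_compose)
  then have lim: "energy a b \<longlonglongrightarrow> 0"
    unfolding energy_def using tendsto_diff[OF a, of "\<lambda>n. G (b n)" 0] by (simp add: G_0)
  have "incseq (energy a b)" using energy_mono[OF orb] by (auto simp: incseq_def)
  then show le0: "energy a b n \<le> 0" for n using lim by (rule incseq_le)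
  assume bn: "-r \<le> b n"
  have "energy a b m - energy a b n \<le> 2 * (b n)\<^sup>2 * (b m - b n)" if "n \<le> m" for m
  proof (rule energy_increase[OF orb that bn])
    show "b m \<le> r" using b0[of m] r_pos by simp
    fix k assume k: "n \<le> k"
    have bk: "b n \<le> b k" using v_mono[OF orb k] .
    have "a k \<le> G (b k)" using le0[of k] by (simp add: energy_def)
    also have "\<dots> \<le> (b k)\<^sup>2" using bk bn b0[of k] by (intro G_le) auto
    also have "\<dots> \<le> (b n)\<^sup>2" using bk b0[of k] by (simp add: abs_le_square_iff[symmetric])
    finally show "a k \<le> (b n)\<^sup>2" .
  qed
  moreover have "2 * (b n)\<^sup>2 * (b m - b n) \<le> 2 * \<bar>b n\<bar> * (b n)\<^sup>2" for m
  proof -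
    have "2 * (b n)\<^sup>2 * (b m - b n) \<le> 2 * (b n)\<^sup>2 * \<bar>b n\<bar>"
      using b0[of m] b0[of n] by (intro mult_left_mono) auto
    then show ?thesis by (simp add: mult_ac)
  qed
  ultimately have "\<And>m. n \<le> m \<Longrightarrow> energy a b m \<le> energy a b n + 2 * \<bar>b n\<bar> * (b n)\<^sup>2"
    by (smt (verit))
  then have "0 \<le> energy a b n + 2 * \<bar>b n\<bar> * (b n)\<^sup>2"
    by (intro LIMSEQ_le_const2[OF lim]) blast
  then show "- 2 * \<bar>b n\<bar> * (b n)\<^sup>2 \<le> energy a b n" by simp
qed

end

section \<open>Orbits close to the parabola\<close>

context local_regime
begin

lemma K_eta: assumes "0 < \<eta>" "\<eta> \<le> r" shows "0 < K * \<eta>" "K * \<eta> \<le> 1/1000" "\<eta> \<le> K * \<eta>"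
  using K_small[of \<eta>] assms K_ge_1 mult_right_mono[of 1 K \<eta>] by auto

text \<open>The energy of the orbit is its excess \<open>\<delta>\<close>, nearly constant, plus the energy of the critical
orbit at the same time. The latter is of third order in \<open>b\<close>, and \<open>b\<^sup>2\<close> exceeds \<open>v\<^sup>2\<close> by at most a
multiple of the excess.\<close>

lemma energy_left:
  assumes orb: "is_orbit u v" and orb': "is_orbit a b" and start: "a 0 \<le> u 0" "b 0 \<le> v 0"
    and crit: "a \<longlonglongrightarrow> 0" "b \<longlonglongrightarrow> 0" "\<And>n. b n \<le> 0"
    and \<eta>: "0 < \<eta>" "\<eta> \<le> r" "-\<eta> \<le> b n0" and n: "n0 \<le> n" "v n \<le> 0"
  defines "\<delta> \<equiv> excess u v a b n0"
  shows "energy u v n \<le> (1 + 10 * K * \<eta>) * \<delta>"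
    and "(1 - 22 * K * \<eta>) * \<delta> - 2 * \<eta> * (v n)\<^sup>2 \<le> energy u v n"
proof -
  define t where "t = K * \<eta>"
  have t: "0 < t" "t \<le> 1/1000" "\<eta> \<le> t"
    unfolding t_def using K_eta[OF \<eta>(1,2)] by auto
  have v0: "- \<eta> \<le> v n0" using v_ge[OF orb orb' start, of n0] \<eta> by simp
  have v0n: "v n0 \<le> v n" by (rule v_mono[OF orb n(1)])
  have \<delta>0: "0 \<le> \<delta>" unfolding \<delta>_def
    using excess_nonneg[OF orb orb' start, of n0] \<eta> n v0n by simp
  have bn: "-\<eta> \<le> b n" using v_mono[OF orb' n(1)] \<eta> by simp
  have w: "0 \<le> v n - v n0" "v n - v n0 \<le> \<eta>" using v0 v0n n by auto
  have Kw: "0 \<le> K * (v n - v n0)" "K * (v n - v n0) \<le> t"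
    using w K_ge_1 by (auto simp: t_def)
  define e where "e = excess u v a b n"
  have "e \<le> \<delta> * exp (5 * K * (v n - v n0))"
    unfolding e_def \<delta>_def using excess_ratio(2)[OF orb orb' start n(1)] \<eta> n by simp
  also have "\<dots> \<le> \<delta> * (1 + 10 * t)"
  proof (intro mult_left_mono \<delta>0)
    define y where "y = 5 * K * (v n - v n0)"
    have y: "0 \<le> y" "y \<le> 5 * t" using Kw by (auto simp: y_def)
    have "exp y \<le> 1 + y + y\<^sup>2" using y t by (intro exp_bound) auto
    also have "y\<^sup>2 \<le> y" using y t by (simp add: power2_eq_square mult_left_le)
    finally show "exp y \<le> 1 + 10 * t" using y by simp
  qed
  finally have e_le: "e \<le> \<delta> * (1 + 10 * t)" .
  have "\<delta> * (1 - 10 * t) \<le> \<delta> * exp (- 10 * K * (v n - v n0))"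
  proof (intro mult_left_mono \<delta>0)
    show "1 - 10 * t \<le> exp (- 10 * K * (v n - v n0))"
      using exp_ge_add_one_self[of "- 10 * K * (v n - v n0)"] Kw by simp
  qed
  also have "\<dots> \<le> e"
    unfolding e_def \<delta>_def using excess_ratio(1)[OF orb orb' start n(1)] \<eta> n by simp
  finally have e_ge: "\<delta> * (1 - 10 * t) \<le> e" .
  have E: "energy u v n = e + energy a b n" by (simp add: e_def excess_def)
  have "energy a b n \<le> 0" by (rule critical_energy(1)[OF orb' crit])
  then show "energy u v n \<le> (1 + 10 * K * \<eta>) * \<delta>"
    using e_le E by (simp add: t_def algebra_simps)
  have "3/8 * ((b n)\<^sup>2 - (v n)\<^sup>2) \<le> e"
    unfolding e_def using excess_ge(2)[OF orb orb' start, of n] bn \<eta> n by simp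
  then have b2: "(b n)\<^sup>2 \<le> (v n)\<^sup>2 + 3 * e"
    using excess_nonneg[OF orb orb' start, of n] bn \<eta> n by (simp add: e_def)
  have "\<bar>b n\<bar> * (b n)\<^sup>2 \<le> \<eta> * ((v n)\<^sup>2 + 3 * e)"
    using b2 bn crit(3)[of n] \<eta> by (intro mult_mono) auto
  also have "\<dots> = \<eta> * (v n)\<^sup>2 + 3 * (\<eta> * e)" by (simp add: algebra_simps)
  also have "\<eta> * e \<le> t * (\<delta> * 2)"
  proof (rule mult_mono)
    have "\<delta> * (1 + 10 * t) \<le> \<delta> * 2" using t \<delta>0 by (intro mult_left_mono) auto
    then show "e \<le> \<delta> * 2" using e_le by simp
    show "0 \<le> e" unfolding e_def using excess_nonneg[OF orb orb' start, of n] bn \<eta> n by simp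
  qed (use t in auto)
  finally have "\<bar>b n\<bar> * (b n)\<^sup>2 \<le> \<eta> * (v n)\<^sup>2 + 6 * t * \<delta>" by simp
  moreover have "- 2 * \<bar>b n\<bar> * (b n)\<^sup>2 \<le> energy a b n"
    using critical_energy(2)[OF orb' crit] bn \<eta> by simp
  ultimately have "e - 2 * (\<eta> * (v n)\<^sup>2 + 6 * t * \<delta>) \<le> energy u v n" using E by simp
  then show "(1 - 22 * K * \<eta>) * \<delta> - 2 * \<eta> * (v n)\<^sup>2 \<le> energy u v n"
    using e_ge by (simp add: t_def algebra_simps)
qed

text \<open>Near \<open>0\<close> the orbit follows the parabola \<open>u = \<delta> + v\<^sup>2 / 2\<close>. Up to the crossing of \<open>0\<close> this is the
assumption on the energy. After the crossing, the energy gained up to time \<open>n\<close> is at most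
twice the largest step times the distance, and the largest step is in turn bounded by the energy
at time \<open>n\<close> plus squared positions. For a short distance this inequality can be solved for the
energy.\<close>

lemma near_parabola:
  assumes orb: "is_orbit u v" and \<eta>: "0 < \<eta>" "\<eta> \<le> r" and \<delta>: "0 < \<delta>" "\<delta> \<le> 1/16"
    and v0: "-\<eta> \<le> v n0" "v n0 \<le> 0"
    and upper: "\<And>n. n0 \<le> n \<Longrightarrow> v n \<le> 0 \<Longrightarrow> energy u v n \<le> (1 + 10 * K * \<eta>) * \<delta>"
    and lower: "\<And>n. n0 \<le> n \<Longrightarrow> v n \<le> 0 \<Longrightarrow> (1 - 22 * K * \<eta>) * \<delta> - 2 * \<eta> * (v n)\<^sup>2 \<le> energy u v n"
    and n: "n0 \<le> n" "v n \<le> \<eta>"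
  shows "\<bar>u n - (\<delta> + (v n)\<^sup>2 / 2)\<bar> \<le> 40 * K * \<eta> * (\<delta> + (v n)\<^sup>2 / 2)"
proof -
  define t where "t = K * \<eta>"
  have t: "0 < t" "t \<le> 1/1000" "\<eta> \<le> t"
    unfolding t_def using K_eta[OF \<eta>(1,2)] by auto
  have vn: "-\<eta> \<le> v n" using v_mono[OF orb n(1)] v0 by simp
  have pos: "0 \<le> t * \<delta>" "0 \<le> t * (v n)\<^sup>2" using t \<delta> by auto
  have "K * \<bar>v n\<bar> * (v n)\<^sup>2 \<le> t * (v n)\<^sup>2"
    unfolding t_def using K_ge_1 vn n by (intro mult_right_mono mult_left_mono) auto
  then have Gn: "\<bar>G (v n) - (v n)\<^sup>2 / 2\<bar> \<le> t * (v n)\<^sup>2"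
    using G_taylor[of "v n"] vn n \<eta> by linarith
  have "(1 - 24 * t) * \<delta> - 2 * (t * (v n)\<^sup>2) \<le> energy u v n \<and>
        energy u v n \<le> (1 + 30 * t) * \<delta> + 8 * (t * (v n)\<^sup>2)"
  proof (cases "v n \<le> 0")
    case True
    have "\<eta> * (v n)\<^sup>2 \<le> t * (v n)\<^sup>2" using t by (intro mult_right_mono) auto
    then show ?thesis
      using upper[OF n(1) True] lower[OF n(1) True] pos by (simp add: t_def algebra_simps)
  next
    case False
    define p where "p = (LEAST p. n0 \<le> p \<and> 0 < v p)"
    have p: "n0 \<le> p" "0 < v p"
      unfolding p_def using LeastI[of "\<lambda>p. n0 \<le> p \<and> 0 < v p" n] n False by auto
    have pn: "p \<le> n" unfolding p_def using n False by (intro Least_le) auto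
    have "n0 \<noteq> p" using p v0 by auto
    then obtain q where q: "p = Suc q" "n0 \<le> q" using p by (cases p) auto
    have vq: "v q \<le> 0"
    proof (rule ccontr)
      assume "\<not> v q \<le> 0"
      then have "p \<le> q" unfolding p_def using q by (intro Least_le) auto
      then show False using q by simp
    qed
    have vq': "-\<eta> \<le> v q" using v_mono[OF orb q(2)] v0 by simp
    have qn: "q \<le> n" using pn q by simp
    note Eq = upper[OF q(2) vq] lower[OF q(2) vq]
    (* Stepping over 0 from v q costs a step of length u q, which forces v q to be tiny. *)
    have "- v q \<le> u q" using p v_Suc[OF orb, of q] q by simp
    also have "u q \<le> (1 + 10 * t) * \<delta> + (v q)\<^sup>2"
      using Eq(1) G_le[of "v q"] vq vq' \<eta> by (simp add: energy_def t_def mult_ac)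
    also have "(v q)\<^sup>2 \<le> 1/2 * (- v q)"
    proof -
      have "(- v q) * (- v q) \<le> 1/2 * (- v q)"
        using vq vq' \<eta> r_le by (intro mult_right_mono) auto
      then show ?thesis by (simp add: power2_eq_square)
    qed
    also have "(1 + 10 * t) * \<delta> \<le> 2 * \<delta>" using t \<delta> by (intro mult_right_mono) auto
    finally have "- v q \<le> 4 * \<delta>" by simp
    then have "(- v q) * (- v q) \<le> (4 * \<delta>) * (4 * \<delta>)" using vq by (intro mult_mono) auto
    also have "\<dots> \<le> 1 * \<delta>" using \<delta> by simp
    finally have vq2: "(v q)\<^sup>2 \<le> \<delta>" by (simp add: power2_eq_square)
    define E where "E = energy u v n"
    have mono: "energy u v k \<le> E" if "k \<le> n" for k
      unfolding E_def by (rule energy_mono[OF orb that])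
    have "\<eta> * (v q)\<^sup>2 \<le> t * \<delta>" using t vq2 \<delta> by (intro mult_mono) auto
    then have "(1 - 24 * t) * \<delta> \<le> energy u v q" using Eq(2) by (simp add: t_def algebra_simps)
    then have E_ge: "(1 - 24 * t) * \<delta> \<le> E" using mono[OF qn] by simp
    moreover have "0 \<le> (1 - 24 * t) * \<delta>" using t \<delta>(1) by (intro mult_nonneg_nonneg) auto
    ultimately have E0: "0 \<le> E" by simp
    define B where "B = E + (v q)\<^sup>2 + (v n)\<^sup>2"
    have "E - energy u v q \<le> 2 * B * (v n - v q)"
      unfolding E_def
    proof (rule energy_increase[OF orb qn])
      fix k assume k: "q \<le> k" "k < n"
      have vk: "v q \<le> v k" "v k \<le> v n" using v_mono[OF orb] k by auto
      have "u k \<le> E + G (v k)" using mono[of k] k by (simp add: energy_def)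
      also have "G (v k) \<le> (v k)\<^sup>2" using vk vq' n \<eta> by (intro G_le) auto
      also have "(v k)\<^sup>2 \<le> (v q)\<^sup>2 + (v n)\<^sup>2"
      proof (cases "v k \<le> 0")
        case True
        then have "(v k)\<^sup>2 \<le> (v q)\<^sup>2" using vk by (simp add: abs_le_square_iff[symmetric])
        then show ?thesis by (simp add: add_increasing2)
      next
        case False
        then have "(v k)\<^sup>2 \<le> (v n)\<^sup>2" using vk by (simp add: abs_le_square_iff[symmetric])
        then show ?thesis by (simp add: add_increasing)
      qed
      finally show "u k \<le> B" by (simp add: B_def)
    qed (use vq' n \<eta> in auto)
    also have "\<dots> \<le> 2 * B * (2 * t)"
      using vq' n t E0 by (intro mult_left_mono) (auto simp: B_def)
    finally have "E \<le> (1 + 10 * t) * \<delta> + 4 * t * (E + \<delta> + (v n)\<^sup>2)"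
    proof -
      assume "E - energy u v q \<le> 2 * B * (2 * t)"
      moreover have "t * (v q)\<^sup>2 \<le> t * \<delta>" using vq2 t by (intro mult_left_mono) auto
      ultimately show ?thesis using Eq(1) by (simp add: B_def t_def algebra_simps)
    qed
    then have "(1 - 4 * t) * E \<le> (1 + 14 * t) * \<delta> + 4 * t * (v n)\<^sup>2" by (simp add: algebra_simps)
    also have "\<dots> \<le> (1 - 4 * t) * ((1 + 30 * t) * \<delta> + 8 * (t * (v n)\<^sup>2))"
    proof -
      have "0 \<le> (12 - 120 * t) * (t * \<delta>) + (4 - 32 * t) * (t * (v n)\<^sup>2)"
        using \<delta>(1) t by (intro add_nonneg_nonneg mult_nonneg_nonneg) auto
      then show ?thesis by (simp add: algebra_simps)
    qed
    finally have "E \<le> (1 + 30 * t) * \<delta> + 8 * (t * (v n)\<^sup>2)" using t by simp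
    then show ?thesis using E_ge pos unfolding E_def by simp
  qed
  then have "\<delta> - 24 * (t * \<delta>) - 2 * (t * (v n)\<^sup>2) \<le> energy u v n"
    "energy u v n \<le> \<delta> + 30 * (t * \<delta>) + 8 * (t * (v n)\<^sup>2)" by (simp_all add: algebra_simps)
  moreover have "u n = energy u v n + G (v n)" by (simp add: energy_def)
  moreover have "\<bar>x - (\<delta> + w)\<bar> \<le> 40 * A + 20 * B"
    if "x = e + g" "\<bar>g - w\<bar> \<le> B" "\<delta> - 24 * A - 2 * B \<le> e" "e \<le> \<delta> + 30 * A + 8 * B" "0 \<le> A" "0 \<le> B"
    for x w A B e g :: real
    using that by linarith
  ultimately have "\<bar>u n - (\<delta> + (v n)\<^sup>2 / 2)\<bar> \<le> 40 * (t * \<delta>) + 20 * (t * (v n)\<^sup>2)"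
    using Gn pos by blast
  also have "\<dots> = 40 * K * \<eta> * (\<delta> + (v n)\<^sup>2 / 2)" by (simp add: t_def algebra_simps)
  finally show ?thesis .
qed

end

section \<open>Passage time\<close>

context local_regime
begin

text \<open>The time that the flow \<open>dv/dt = \<delta> + v\<^sup>2 / 2\<close> needs from \<open>0\<close> to \<open>x\<close>.\<close>

definition clock :: "real \<Rightarrow> real \<Rightarrow> real" where
  "clock \<delta> x = sqrt (2 / \<delta>) * arctan (x / sqrt (2 * \<delta>))"

lemma clock_deriv:
  assumes "0 < \<delta>"
  shows "(clock \<delta> has_real_derivative 1 / (\<delta> + x\<^sup>2 / 2)) (at x)"
proof -
  define c where "c = sqrt (2 * \<delta>)"
  have c: "c > 0" "c\<^sup>2 = 2 * \<delta>" using assms by (auto simp: c_def)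
  have "((\<lambda>x. sqrt (2 / \<delta>) * arctan (x / c)) has_real_derivative
          sqrt (2 / \<delta>) * (inverse (1 + (x / c)\<^sup>2) * (1 / c))) (at x)"
    using c(1) by (auto intro!: derivative_eq_intros)
  moreover have "sqrt (2 / \<delta>) * (1 / c) = 1 / \<delta>"
    using assms by (simp add: c_def real_sqrt_divide real_sqrt_mult)
  then have "sqrt (2 / \<delta>) * (inverse (1 + (x / c)\<^sup>2) * (1 / c)) = 1 / \<delta> * inverse (1 + (x / c)\<^sup>2)"
    by (metis mult.assoc mult.commute)
  moreover have "1 / \<delta> * inverse (1 + (x / c)\<^sup>2) = 1 / (\<delta> + x\<^sup>2 / 2)"
    using assms by (simp add: power_divide c(2) divide_simps)
  ultimately show ?thesis by (simp add: clock_def[abs_def] c_def)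
qed

text \<open>By the mean value theorem a step advances the clock by \<open>u / (\<delta> + z\<^sup>2 / 2)\<close> with \<open>z\<close> inside the step.
The step is so short that the parabola changes only by a factor close to one along it, so this
ratio is close to one.\<close>

lemma clock_step:
  assumes orb: "is_orbit u v" and \<eta>: "0 < \<eta>" "\<eta> \<le> r" and \<delta>: "0 < \<delta>" "\<delta> \<le> \<eta>\<^sup>2"
    and v: "\<bar>v n\<bar> \<le> \<eta>"
    and near: "\<bar>u n - (\<delta> + (v n)\<^sup>2 / 2)\<bar> \<le> 40 * K * \<eta> * (\<delta> + (v n)\<^sup>2 / 2)"
  shows "1 - 50 * K * \<eta> \<le> clock \<delta> (v (Suc n)) - clock \<delta> (v n)"
    and "clock \<delta> (v (Suc n)) - clock \<delta> (v n) \<le> 1 + 50 * K * \<eta>"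
proof -
  define t where "t = K * \<eta>"
  have t: "0 < t" "t \<le> 1/1000" "\<eta> \<le> t" unfolding t_def using K_eta[OF \<eta>(1,2)] by auto
  define Q where "Q = \<delta> + (v n)\<^sup>2 / 2"
  have Q: "0 < Q" using \<delta> by (simp add: Q_def add_pos_nonneg)
  have uQ: "\<bar>u n - Q\<bar> \<le> 40 * (t * Q)" using near by (simp add: Q_def t_def mult_ac)
  have tQ: "0 < t * Q" "t * Q \<le> 1/1000 * Q" using t Q by (simp, intro mult_right_mono) auto
  have u: "0 < u n" "u n \<le> 26/25 * Q" using uQ tQ Q by linarith+
  have "(v n)\<^sup>2 \<le> \<eta>\<^sup>2" using v \<eta> by (simp add: abs_le_square_iff[symmetric])
  then have "u n \<le> 2 * \<eta>\<^sup>2" using u \<delta> by (simp add: Q_def)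
  also have "2 * \<eta>\<^sup>2 \<le> \<eta>"
  proof -
    have "\<eta> * \<eta> \<le> 1/2 * \<eta>" using \<eta> r_le by (intro mult_right_mono) auto
    then show ?thesis by (simp add: power2_eq_square)
  qed
  finally have u\<eta>: "u n \<le> \<eta>" .
  have vs: "v (Suc n) = u n + v n" by (rule v_Suc[OF orb])
  obtain z where z: "v n < z" "z < v (Suc n)"
    "clock \<delta> (v (Suc n)) - clock \<delta> (v n) = (v (Suc n) - v n) * (1 / (\<delta> + z\<^sup>2 / 2))"
    using MVT2[of "v n" "v (Suc n)" "clock \<delta>" "\<lambda>z. 1 / (\<delta> + z\<^sup>2 / 2)"] clock_deriv[OF \<delta>(1)] u vs by auto
  define R where "R = \<delta> + z\<^sup>2 / 2"
  have R: "0 < R" using \<delta> by (simp add: R_def add_pos_nonneg)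
  have "\<bar>R - Q\<bar> = \<bar>z - v n\<bar> * \<bar>z + v n\<bar> / 2"
    by (simp add: R_def Q_def power2_eq_square abs_mult[symmetric] algebra_simps abs_divide)
       (simp add: diff_divide_distrib[symmetric] abs_divide)
  also have "\<dots> \<le> u n * (3 * \<eta>) / 2"
    using z vs v u u\<eta> by (intro divide_right_mono mult_mono) auto
  also have "u n * (3 * \<eta>) / 2 \<le> (26/25 * Q) * (3 * t) / 2"
    using u t \<eta> Q by (intro divide_right_mono mult_mono) auto
  finally have RQ: "\<bar>R - Q\<bar> \<le> 3 * (t * Q)" using tQ by (simp add: mult.commute[of Q t])
  have eq: "clock \<delta> (v (Suc n)) - clock \<delta> (v n) = u n / R" using z vs by (simp add: R_def)
  have tt: "0 \<le> t * (t * Q)" "t * (t * Q) \<le> 1/1000 * (t * Q)" using t tQ by (simp, intro mult_right_mono) auto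
  have "t * \<bar>R - Q\<bar> \<le> t * (3 * (t * Q))" using RQ t by (intro mult_left_mono) auto
  moreover have "\<bar>t * R - t * Q\<bar> = t * \<bar>R - Q\<bar>" using t by (simp add: abs_mult flip: right_diff_distrib)
  ultimately have tR: "\<bar>t * R - t * Q\<bar> \<le> 3 * (t * (t * Q))" by simp
  have "u n \<le> (1 + 50 * t) * R" "(1 - 50 * t) * R \<le> u n"
    unfolding distrib_right left_diff_distrib mult.assoc mult_1
    using RQ tR uQ tt tQ by linarith+
  then show "1 - 50 * K * \<eta> \<le> clock \<delta> (v (Suc n)) - clock \<delta> (v n)"
    and "clock \<delta> (v (Suc n)) - clock \<delta> (v n) \<le> 1 + 50 * K * \<eta>"
    using R unfolding eq by (simp_all add: t_def field_simps)
qed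

text \<open>\<open>N\<close> is the first time at which the orbit has left the window to the right. Summing the previous
estimate, \<open>N\<close> is determined by the clock; the size of the step at that time is bounded above and
away from zero, independently of \<open>\<delta>\<close>.\<close>

lemma passage:
  assumes orb: "is_orbit u v" and \<eta>: "0 < \<eta>" "\<eta> \<le> r" and \<delta>: "0 < \<delta>" "\<delta> \<le> \<eta>\<^sup>2"
    and v0: "-\<eta> \<le> v n0" "v n0 \<le> 0" and esc: "filterlim v at_top sequentially"
    and near: "\<And>n. n0 \<le> n \<Longrightarrow> v n \<le> \<eta> \<Longrightarrow>
       \<bar>u n - (\<delta> + (v n)\<^sup>2 / 2)\<bar> \<le> 40 * K * \<eta> * (\<delta> + (v n)\<^sup>2 / 2)"
  obtains N where "n0 \<le> N" "\<eta> \<le> v N" "\<eta>\<^sup>2 / 16 \<le> u N" "u N \<le> Psi_inf \<Psi>"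
    "(1 - 50 * K * \<eta>) * real (N - n0) \<le> clock \<delta> (v N) - clock \<delta> (v n0)"
    "clock \<delta> (v N) - clock \<delta> (v n0) \<le> (1 + 50 * K * \<eta>) * real (N - n0)"
proof -
  have "\<forall>\<^sub>F n in sequentially. \<eta> < v n" using esc by (simp add: filterlim_at_top_dense)
  then obtain M where M: "\<eta> < v M" by (auto simp: eventually_sequentially)
  define N where "N = (LEAST n. \<eta> < v n)"
  have N: "\<eta> < v N" unfolding N_def using M by (rule LeastI)
  have before: "v k \<le> \<eta>" if "k < N" for k
    using not_less_Least[of k "\<lambda>n. \<eta> < v n"] that unfolding N_def by auto
  have n0N: "n0 < N"
  proof (rule ccontr)
    assume "\<not> n0 < N"
    then have "v N \<le> v n0" by (intro v_mono[OF orb]) simp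
    then show False using N v0 \<eta> by simp
  qed
  have clock: "(1 - 50 * K * \<eta>) * real (m - n0) \<le> clock \<delta> (v m) - clock \<delta> (v n0) \<and>
    clock \<delta> (v m) - clock \<delta> (v n0) \<le> (1 + 50 * K * \<eta>) * real (m - n0)" if "n0 \<le> m" "m \<le> N" for m
    using that
  proof (induction m rule: dec_induct)
    case (step m)
    have le: "v m \<le> \<eta>" using before step by simp
    have "-\<eta> \<le> v m" using v_mono[OF orb, of n0 m] step v0 by simp
    then have ab: "\<bar>v m\<bar> \<le> \<eta>" using le by simp
    have "real (Suc m - n0) = real (m - n0) + 1" using step by (simp add: of_nat_diff)
    then show ?case
      using clock_step[OF orb \<eta> \<delta> ab near[OF step(1) le]] step by (simp add: algebra_simps)
  qed simp
  obtain q where q: "N = Suc q" "n0 \<le> q" using n0N by (cases N) auto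
  have t: "0 < K * \<eta>" "K * \<eta> \<le> 1/1000" "\<eta> \<le> K * \<eta>" using K_eta[OF \<eta>] by auto
  define Q where "Q = \<delta> + (v q)\<^sup>2 / 2"
  have Q: "0 < Q" using \<delta> by (simp add: Q_def add_pos_nonneg)
  have vq: "v q \<le> \<eta>" "-\<eta> \<le> v q" using before v_mono[OF orb q(2)] v0 q by auto
  have vqN: "v q + u q > \<eta>" using N v_Suc[OF orb, of q] q by simp
  have "40 * K * \<eta> * Q \<le> 1/2 * Q" using t Q by (intro mult_right_mono) auto
  then have uQ: "1/2 * Q \<le> u q" "u q \<le> 2 * Q"
    using near[OF q(2) vq(1)] unfolding Q_def[symmetric] by (auto simp: abs_le_iff)
  have \<eta>2: "\<eta>\<^sup>2 \<le> 1/2 * \<eta>" unfolding power2_eq_square using \<eta> r_le by (intro mult_right_mono) auto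
  have lo: "\<eta>\<^sup>2 / 16 \<le> u q"
  proof (cases "\<eta> / 2 \<le> v q")
    case True
    then have "(\<eta>/2)\<^sup>2 \<le> (v q)\<^sup>2" using \<eta> by (intro power_mono) auto
    then have "\<eta>\<^sup>2 / 4 \<le> (v q)\<^sup>2" by (simp add: power_divide)
    then show ?thesis using uQ \<delta> by (simp add: Q_def)
  next
    case False
    then show ?thesis using vqN \<eta>2 \<eta> by simp
  qed
  have "(v q)\<^sup>2 \<le> \<eta>\<^sup>2" using vq \<eta> by (simp add: abs_le_square_iff[symmetric])
  then have hi: "u q \<le> 1" using uQ \<delta> \<eta>2 \<eta> r_le by (simp add: Q_def)
  have uN: "u N = u q * \<Psi> (v N)" unfolding q by (rule u_Suc[OF orb])
  have "1 \<le> \<Psi> (v N)" using N \<eta> by (intro ge_1) simp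
  then have "u q * 1 \<le> u N" unfolding uN using u_nonneg[OF orb] by (intro mult_left_mono) auto
  moreover have "u N \<le> 1 * Psi_inf \<Psi>"
    unfolding uN using hi le_Psi_inf pos[of "v N"] by (intro mult_mono) auto
  ultimately show ?thesis
    using that[of N] clock[of N] n0N N lo by simp
qed

end

section \<open>From the passage time to the free energy\<close>

context local_regime
begin

text \<open>The passage through the window takes about \<open>sqrt (2 / \<delta>)\<close> times the increase of the arctangent,
which tends to \<open>\<pi> / 2 + \<alpha>\<close>: here \<open>\<alpha> = 0\<close> for a start at the bottom of the parabola and \<open>\<alpha> = \<pi> / 2\<close>
for a start on its left branch. Each unit of time costs a factor \<open>\<Psi>(\<infinity>)\<close>; the time \<open>n0\<close> before
the window and the bounded factor after it vanish after multiplication by \<open>sqrt \<epsilon>\<close>.\<close>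

lemma log_free_energy_asymptotics:
  fixes u0 \<delta> :: "real \<Rightarrow> real"
  assumes \<eta>: "0 < \<eta>" "\<eta> \<le> r"
    and ev: "\<forall>\<^sub>F \<epsilon> in at_right 0. 0 \<le> u0 \<epsilon> \<and> 0 < \<delta> \<epsilon> \<and>
       -\<eta> \<le> v_seq \<Psi> (u0 \<epsilon>) v0 n0 \<and> v_seq \<Psi> (u0 \<epsilon>) v0 n0 \<le> 0 \<and>
       filterlim (v_seq \<Psi> (u0 \<epsilon>) v0) at_top sequentially \<and>
       (\<forall>n\<ge>n0. v_seq \<Psi> (u0 \<epsilon>) v0 n \<le> \<eta> \<longrightarrow>
          \<bar>u_seq \<Psi> (u0 \<epsilon>) v0 n - (\<delta> \<epsilon> + (v_seq \<Psi> (u0 \<epsilon>) v0 n)\<^sup>2 / 2)\<bar>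
            \<le> 40 * K * \<eta> * (\<delta> \<epsilon> + (v_seq \<Psi> (u0 \<epsilon>) v0 n)\<^sup>2 / 2))"
    and d: "0 < d" "((\<lambda>\<epsilon>. \<delta> \<epsilon> / \<epsilon>) \<longlongrightarrow> d) (at_right 0)"
    and \<alpha>: "((\<lambda>\<epsilon>. arctan (v_seq \<Psi> (u0 \<epsilon>) v0 n0 / sqrt (2 * \<delta> \<epsilon>))) \<longlongrightarrow> - \<alpha>) (at_right 0)"
  defines "X \<equiv> sqrt 2 * (pi / 2 + \<alpha>) / sqrt d * ln (Psi_inf \<Psi>)"
  shows "\<forall>\<^sub>F \<epsilon> in at_right 0.
    - X / (1 - 50 * K * \<eta>) - \<eta> \<le> sqrt \<epsilon> * ln (free_energy \<Psi> (u0 \<epsilon>) v0) \<and>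
    sqrt \<epsilon> * ln (free_energy \<Psi> (u0 \<epsilon>) v0) \<le> - X / (1 + 50 * K * \<eta>) + \<eta>"
proof -
  define P where "P = Psi_inf \<Psi>"
  have P: "1 < P" "0 < ln P" using Psi_inf_gt_1 by (auto simp: P_def)
  define \<tau> where "\<tau> = 50 * K * \<eta>"
  have \<tau>: "0 < \<tau>" "\<tau> < 1" using K_eta[OF \<eta>] by (auto simp: \<tau>_def)
  have scale1: "ln P * y / (1 + \<tau>) \<le> ln P * (s * m)" if "y \<le> s * ((1 + \<tau>) * m)" for y s m
    using mult_left_mono[OF that, of "ln P"] P \<tau> by (simp add: pos_divide_le_eq mult_ac)
  have scale2: "ln P * (s * m) \<le> ln P * y / (1 - \<tau>)" if "s * ((1 - \<tau>) * m) \<le> y" for y s m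
    using mult_left_mono[OF that, of "ln P"] P \<tau> by (simp add: pos_le_divide_eq mult_ac)
  have sq: "0 < \<eta>\<^sup>2 / 16" using \<eta> by simp
  obtain S where S: "\<And>u0 v0 N. 0 \<le> u0 \<Longrightarrow> \<eta> \<le> v_seq \<Psi> u0 v0 N \<Longrightarrow> \<eta>\<^sup>2 / 16 \<le> u_seq \<Psi> u0 v0 N \<Longrightarrow>
    exp (-S) * u_seq \<Psi> u0 v0 N \<le> free_energy \<Psi> u0 v0 * P ^ N \<and>
    free_energy \<Psi> u0 v0 * P ^ N \<le> u_seq \<Psi> u0 v0 N"
    using free_energy_after_escape[OF \<eta>(1) sq] unfolding P_def by blast
  (* lo and hi will bound sqrt \<epsilon> * ln F; the exit position v N enters them only through \<eta> \<le> v N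
     and through arctan < pi / 2. *)
  define phase where "phase \<epsilon> = arctan (v_seq \<Psi> (u0 \<epsilon>) v0 n0 / sqrt (2 * \<delta> \<epsilon>))" for \<epsilon>
  define hi where "hi \<epsilon> = sqrt \<epsilon> * ln P -
    ln P * (sqrt 2 / sqrt (\<delta> \<epsilon> / \<epsilon>) * (arctan (\<eta> / sqrt (2 * \<delta> \<epsilon>)) - phase \<epsilon>)) / (1 + \<tau>)" for \<epsilon>
  define lo where "lo \<epsilon> = sqrt \<epsilon> * (ln (\<eta>\<^sup>2 / 16) - S - real n0 * ln P) -
    ln P * (sqrt 2 / sqrt (\<delta> \<epsilon> / \<epsilon>) * (pi / 2 - phase \<epsilon>)) / (1 - \<tau>)" for \<epsilon>
  have \<epsilon>0: "((\<lambda>\<epsilon>. \<epsilon>) \<longlongrightarrow> 0) (at_right (0::real))" by (rule tendsto_ident_at)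
  have "((\<lambda>\<epsilon>. \<delta> \<epsilon> / \<epsilon> * \<epsilon>) \<longlongrightarrow> d * 0) (at_right 0)" by (intro tendsto_mult d \<epsilon>0)
  from this[unfolded mult_zero_right] have \<delta>0: "(\<delta> \<longlongrightarrow> 0) (at_right 0)"
    by (rule Lim_transform_eventually) (auto simp: eventually_at_right_field intro!: exI[of _ 1])
  have "((\<lambda>\<epsilon>. sqrt (2 * \<delta> \<epsilon>)) \<longlongrightarrow> sqrt (2 * 0)) (at_right 0)"
    by (intro tendsto_intros \<delta>0)
  moreover have "\<forall>\<^sub>F \<epsilon> in at_right 0. 0 < sqrt (2 * \<delta> \<epsilon>)"
    using ev by eventually_elim simp
  ultimately have "filterlim (\<lambda>\<epsilon>. \<eta> / sqrt (2 * \<delta> \<epsilon>)) at_top (at_right 0)"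
    using \<eta> by (intro LIM_at_top_divide[OF tendsto_const]) auto
  then have at1: "((\<lambda>\<epsilon>. arctan (\<eta> / sqrt (2 * \<delta> \<epsilon>))) \<longlongrightarrow> pi / 2) (at_right 0)"
    by (rule filterlim_compose[OF tendsto_arctan_at_top])
  have s0: "((\<lambda>\<epsilon>. sqrt \<epsilon>) \<longlongrightarrow> 0) (at_right (0::real))"
    using tendsto_real_sqrt[OF \<epsilon>0] by simp
  have "(hi \<longlongrightarrow> 0 * ln P - ln P * (sqrt 2 / sqrt d * (pi / 2 - - \<alpha>)) / (1 + \<tau>)) (at_right 0)"
    unfolding hi_def phase_def using d \<tau> by (intro tendsto_intros s0 at1 \<alpha>) auto
  then have "(hi \<longlongrightarrow> - X / (1 + \<tau>)) (at_right 0)" by (simp add: X_def P_def mult_ac)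
  then have hi: "\<forall>\<^sub>F \<epsilon> in at_right 0. hi \<epsilon> < - X / (1 + \<tau>) + \<eta>"
    by (rule order_tendstoD) (use \<eta> in simp)
  have "(lo \<longlongrightarrow> 0 * (ln (\<eta>\<^sup>2 / 16) - S - real n0 * ln P) -
     ln P * (sqrt 2 / sqrt d * (pi / 2 - - \<alpha>)) / (1 - \<tau>)) (at_right 0)"
    unfolding lo_def phase_def using d \<tau> by (intro tendsto_intros s0 \<alpha>) auto
  then have "(lo \<longlongrightarrow> - X / (1 - \<tau>)) (at_right 0)" by (simp add: X_def P_def mult_ac)
  then have lo: "\<forall>\<^sub>F \<epsilon> in at_right 0. - X / (1 - \<tau>) - \<eta> < lo \<epsilon>"
    by (rule order_tendstoD) (use \<eta> in simp)
  have small: "\<forall>\<^sub>F \<epsilon> in at_right 0. \<delta> \<epsilon> < \<eta>\<^sup>2"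
    using \<delta>0 by (rule order_tendstoD) (use \<eta> in simp)
  have \<epsilon>pos: "\<forall>\<^sub>F \<epsilon> in at_right (0::real). 0 < \<epsilon>" by (rule eventually_at_right_less)
  show ?thesis
    using ev hi lo small \<epsilon>pos unfolding \<tau>_def[symmetric]
  proof eventually_elim
    case (elim \<epsilon>)
    define u v where "u = u_seq \<Psi> (u0 \<epsilon>) v0" and "v = v_seq \<Psi> (u0 \<epsilon>) v0"
    note elim = elim[folded u_def v_def]
    have orb: "is_orbit u v" using elim by (simp add: u_def v_def is_orbit_seq)
    define D where "D = \<delta> \<epsilon>"
    have D: "0 < D" "D \<le> \<eta>\<^sup>2" using elim by (auto simp: D_def)
    obtain N where N: "n0 \<le> N" "\<eta> \<le> v N" "\<eta>\<^sup>2 / 16 \<le> u N" "u N \<le> P"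
      "(1 - 50 * K * \<eta>) * real (N - n0) \<le> clock D (v N) - clock D (v n0)"
      "clock D (v N) - clock D (v n0) \<le> (1 + 50 * K * \<eta>) * real (N - n0)"
      using passage[OF orb \<eta> D, of n0] elim unfolding P_def D_def by blast
    define F where "F = free_energy \<Psi> (u0 \<epsilon>) v0"
    have FS: "exp (-S) * u N \<le> F * P ^ N" "F * P ^ N \<le> u N"
      using S[of "u0 \<epsilon>" v0 N] elim N unfolding F_def u_def v_def by auto
    have uN: "0 < u N" using N(3) sq by linarith
    have "0 < F * P ^ N" using FS(1) uN by (meson exp_gt_zero less_le_trans mult_pos_pos)
    then have F: "0 < F" using P by (simp add: zero_less_mult_iff)
    have lnF: "ln (F * P ^ N) = ln F + real N * ln P" using F P by (simp add: ln_mult ln_realpow)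
    have "ln (exp (-S) * u N) \<le> ln (F * P ^ N)" using FS(1) uN F P by (subst ln_le_cancel_iff) auto
    then have "- S + ln (u N) \<le> ln F + real N * ln P" using uN lnF by (simp add: ln_mult)
    moreover have "ln (\<eta>\<^sup>2 / 16) \<le> ln (u N)" using N(3) uN sq by (simp only: ln_le_cancel_iff)
    ultimately have F_ge: "ln (\<eta>\<^sup>2 / 16) - S - real N * ln P \<le> ln F" by simp
    have "ln (F * P ^ N) \<le> ln P" using FS(2) N uN F P by (subst ln_le_cancel_iff) auto
    then have F_le: "ln F \<le> ln P - real N * ln P" using lnF by simp
    have Nn: "real N = real (N - n0) + real n0" using N by simp
    have se: "sqrt \<epsilon> * sqrt (2 / D) = sqrt 2 / sqrt (D / \<epsilon>)"
      using elim D by (simp add: real_sqrt_divide)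
    have cl: "sqrt \<epsilon> * (clock D (v N) - clock D (v n0)) =
        sqrt 2 / sqrt (D / \<epsilon>) * (arctan (v N / sqrt (2 * D)) - phase \<epsilon>)"
      by (simp add: clock_def phase_def D_def[symmetric] v_def[symmetric] se[symmetric] right_diff_distrib)
    have pre: "0 \<le> sqrt 2 / sqrt (D / \<epsilon>)" using elim D by simp
    have s: "0 < sqrt \<epsilon>" using elim by simp
    have "sqrt 2 / sqrt (D / \<epsilon>) * (arctan (\<eta> / sqrt (2 * D)) - phase \<epsilon>) \<le>
        sqrt \<epsilon> * (clock D (v N) - clock D (v n0))"
      unfolding cl using N D by (intro mult_left_mono pre) (auto simp: arctan_le_iff divide_right_mono)
    also have "\<dots> \<le> sqrt \<epsilon> * ((1 + \<tau>) * real (N - n0))"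
      using N s unfolding \<tau>_def by (intro mult_left_mono) auto
    finally have time_ge: "ln P * (sqrt 2 / sqrt (D / \<epsilon>) * (arctan (\<eta> / sqrt (2 * D)) - phase \<epsilon>)) / (1 + \<tau>)
        \<le> ln P * (sqrt \<epsilon> * real (N - n0))" by (rule scale1)
    have "sqrt \<epsilon> * ((1 - \<tau>) * real (N - n0)) \<le> sqrt \<epsilon> * (clock D (v N) - clock D (v n0))"
      using N s unfolding \<tau>_def by (intro mult_left_mono) auto
    also have "\<dots> \<le> sqrt 2 / sqrt (D / \<epsilon>) * (pi / 2 - phase \<epsilon>)"
      unfolding cl using arctan_ubound[of "v N / sqrt (2 * D)"] by (intro mult_left_mono pre) simp
    finally have time_le: "ln P * (sqrt \<epsilon> * real (N - n0)) \<le>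
        ln P * (sqrt 2 / sqrt (D / \<epsilon>) * (pi / 2 - phase \<epsilon>)) / (1 - \<tau>)" by (rule scale2)
    have "sqrt \<epsilon> * ln F \<le> sqrt \<epsilon> * (ln P - real N * ln P)"
      using F_le s by (intro mult_left_mono) auto
    also have "\<dots> \<le> sqrt \<epsilon> * ln P - ln P * (sqrt \<epsilon> * real (N - n0))"
      using s P by (simp add: Nn algebra_simps)
    also have "\<dots> \<le> hi \<epsilon>" using time_ge by (simp add: hi_def D_def)
    finally have 1: "sqrt \<epsilon> * ln F \<le> - X / (1 + \<tau>) + \<eta>" using elim by simp
    have "lo \<epsilon> \<le> sqrt \<epsilon> * (ln (\<eta>\<^sup>2 / 16) - S - real n0 * ln P) - ln P * (sqrt \<epsilon> * real (N - n0))"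
      using time_le by (simp add: lo_def D_def)
    also have "\<dots> = sqrt \<epsilon> * (ln (\<eta>\<^sup>2 / 16) - S - real N * ln P)"
      by (simp add: Nn algebra_simps)
    also have "\<dots> \<le> sqrt \<epsilon> * ln F" using F_ge s by (intro mult_left_mono) auto
    finally have "- X / (1 - \<tau>) - \<eta> \<le> sqrt \<epsilon> * ln F" using elim by simp
    with 1 show ?case by (simp add: F_def)
  qed
qed

end

section \<open>The effective energy of a start above the critical curve\<close>

context local_regime
begin

text \<open>The gap in the steps shrinks at most geometrically, so it is at least proportional to \<open>\<epsilon>\<close> at any
fixed time. This keeps the slopes of the excess positive.\<close>

lemma (in recursion) step_gap_ge:
  assumes orb: "is_orbit u v" and orb': "is_orbit a b" and start: "a 0 \<le> u 0" "b 0 \<le> v 0"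
  shows "(u 0 - a 0) * \<Psi> (b 0) ^ n \<le> u n - a n"
proof (induction n)
  case (Suc n)
  have le: "a n \<le> u n" "b (Suc n) \<le> v (Suc n)" using orbit_le[OF orb' orb start] by auto
  have b: "b 0 \<le> b (Suc n)" by (rule v_mono[OF orb']) simp
  have "(u 0 - a 0) * \<Psi> (b 0) ^ n * \<Psi> (b 0) \<le> (u n - a n) * \<Psi> (b (Suc n))"
    using Suc Psi_mono[OF b] le pos[of "b 0"] by (intro mult_mono) auto
  also have "\<dots> = u n * \<Psi> (b (Suc n)) - a (Suc n)" by (simp add: u_Suc[OF orb'] algebra_simps)
  also have "u n * \<Psi> (b (Suc n)) \<le> u (Suc n)"
    unfolding u_Suc[OF orb] using u_nonneg[OF orb] Psi_mono[OF le(2)] by (intro mult_left_mono) auto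
  finally show ?case by (simp add: mult_ac)
qed simp

lemma (in recursion) v_seq_right_limit:
  "((\<lambda>\<epsilon>. v_seq \<Psi> (h + \<epsilon>) v n) \<longlongrightarrow> v_seq \<Psi> h v n) (at_right 0)"
proof -
  have "((\<lambda>u. v_seq \<Psi> u v n) \<longlongrightarrow> v_seq \<Psi> h v n) (at h)"
    using seq_isCont(2) by (simp add: isCont_def)
  then have "((\<lambda>\<epsilon>. v_seq \<Psi> (h + \<epsilon>) v n) \<longlongrightarrow> v_seq \<Psi> h v n) (at 0)" by (rule LIM_offset_zero)
  then show ?thesis by (rule filterlim_at_split[THEN iffD1, THEN conjunct2])
qed

definition critical_excess :: "real \<Rightarrow> nat \<Rightarrow> real \<Rightarrow> real" where
  "critical_excess v n \<epsilon> = (let h = critical_curve \<Psi> v in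
     excess (u_seq \<Psi> (h + \<epsilon>) v) (v_seq \<Psi> (h + \<epsilon>) v) (u_seq \<Psi> h v) (v_seq \<Psi> h v) n)"

lemma critical_excess_slope:
  "\<exists>d. ((\<lambda>\<epsilon>. critical_excess v n \<epsilon> / \<epsilon>) \<longlongrightarrow> d) (at_right 0)"
proof -
  define h where "h = critical_curve \<Psi> v"
  define e where "e u = energy (u_seq \<Psi> u v) (v_seq \<Psi> u v) n" for u
  have "G field_differentiable at x" for x using G_deriv field_differentiable_def by blast
  then have "(G \<circ> (\<lambda>u. v_seq \<Psi> u v n)) field_differentiable at h"
    using seq_differentiable by (intro field_differentiable_compose) auto
  then have "e field_differentiable at h"
    unfolding e_def energy_def using seq_differentiable
    by (intro field_differentiable_diff) (auto simp: o_def)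
  then obtain d where "(e has_real_derivative d) (at h)"
    unfolding field_differentiable_def by blast
  then have "((\<lambda>\<epsilon>. (e (h + \<epsilon>) - e h) / \<epsilon>) \<longlongrightarrow> d) (at 0)" by (simp add: DERIV_def)
  then have "((\<lambda>\<epsilon>. (e (h + \<epsilon>) - e h) / \<epsilon>) \<longlongrightarrow> d) (at_right 0)"
    by (rule filterlim_at_split[THEN iffD1, THEN conjunct2])
  moreover have "(\<lambda>\<epsilon>. (e (h + \<epsilon>) - e h) / \<epsilon>) = (\<lambda>\<epsilon>. critical_excess v n \<epsilon> / \<epsilon>)"
    by (simp add: critical_excess_def Let_def h_def e_def excess_def)
  ultimately show ?thesis by auto
qed

text \<open>For a fixed time \<open>n\<close> the excess has a slope \<open>d\<^sub>n\<close> at \<open>\<epsilon> = 0\<close>, and the near conservation of the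
excess passes to the slopes. As the critical orbit approaches \<open>0\<close>, they become stationary; their
limit \<open>c\<close> is the ratio of the effective energy \<open>\<delta>\<close> at the bottom of the parabola to \<open>\<epsilon>\<close>.\<close>

lemma slope_limit:
  assumes v: "v < 0"
  defines "b \<equiv> v_seq \<Psi> (critical_curve \<Psi> v) v"
  obtains d c where "\<And>n. ((\<lambda>\<epsilon>. critical_excess v n \<epsilon> / \<epsilon>) \<longlongrightarrow> d n) (at_right 0)" "0 < c"
    "\<And>n. -r \<le> b n \<Longrightarrow> 0 < d n \<and> d n * exp (10 * K * b n) \<le> c \<and> c \<le> d n * exp (- 5 * K * b n)"
proof -
  define h where "h = critical_curve \<Psi> v"
  define a where "a = u_seq \<Psi> h v"
  note b_def = b_def[folded h_def]
  note crit = critical_orbit[OF v, folded h_def, folded a_def b_def]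
  have orb': "is_orbit a b" using is_orbit_seq[of h v] crit(1) by (simp add: a_def b_def)
  obtain d where d: "\<And>n. ((\<lambda>\<epsilon>. critical_excess v n \<epsilon> / \<epsilon>) \<longlongrightarrow> d n) (at_right 0)"
    using critical_excess_slope[of v] by metis
  let ?u = "\<lambda>\<epsilon>. u_seq \<Psi> (h + \<epsilon>) v" and ?v = "\<lambda>\<epsilon>. v_seq \<Psi> (h + \<epsilon>) v"
  have orb: "is_orbit (?u \<epsilon>) (?v \<epsilon>)" if "0 < \<epsilon>" for \<epsilon> using is_orbit_seq[of "h+\<epsilon>" v] crit(1) that by simp
  have ce: "critical_excess v n \<epsilon> = excess (?u \<epsilon>) (?v \<epsilon>) a b n" for n \<epsilon>
    by (simp add: critical_excess_def Let_def h_def a_def b_def)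
  have start: "a 0 \<le> ?u \<epsilon> 0" "b 0 \<le> ?v \<epsilon> 0" if "0 < \<epsilon>" for \<epsilon> using that by (auto simp: a_def b_def)
  have eps_pos: "\<forall>\<^sub>F \<epsilon> in at_right (0::real). 0 < \<epsilon>" by (rule eventually_at_right_less)
  have vlim: "((\<lambda>\<epsilon>. ?v \<epsilon> n) \<longlongrightarrow> b n) (at_right 0)" for n
    unfolding b_def by (rule v_seq_right_limit)
  have neg: "\<forall>\<^sub>F \<epsilon> in at_right 0. ?v \<epsilon> n \<le> 0" for n
    by (rule eventually_mono[OF order_tendstoD(2)[OF vlim crit(2), of n]]) simp
  have dpos: "0 < d n" if bn: "-r \<le> b n" for n
  proof -
    have "\<forall>\<^sub>F \<epsilon> in at_right 0. \<Psi> v ^ n \<le> critical_excess v n \<epsilon> / \<epsilon>"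
      using neg[of n] eps_pos
    proof eventually_elim
      case (elim \<epsilon>)
      have "\<epsilon> * \<Psi> v ^ n \<le> ?u \<epsilon> n - a n"
        using step_gap_ge[OF orb orb' start, of \<epsilon> n] elim by (simp add: a_def b_def)
      also have "\<dots> \<le> critical_excess v n \<epsilon>"
        unfolding ce using elim by (intro excess_ge(1)[OF orb orb' start bn]) auto
      finally show ?case using elim by (simp add: field_simps)
    qed
    then have "\<Psi> v ^ n \<le> d n" by (intro tendsto_lowerbound[OF d]) auto
    moreover have "0 < \<Psi> v ^ n" using pos by simp
    ultimately show ?thesis by simp
  qed
  have ratio: "d n * exp (- 10 * K * (b m - b n)) \<le> d m \<and> d m \<le> d n * exp (5 * K * (b m - b n))"
    if "n \<le> m" "-r \<le> b n" for n m
  proof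
    have "\<forall>\<^sub>F \<epsilon> in at_right 0. critical_excess v n \<epsilon> / \<epsilon> * exp (- 10 * K * (?v \<epsilon> m - ?v \<epsilon> n)) \<le> critical_excess v m \<epsilon> / \<epsilon>"
      using neg[of m] eps_pos
    proof eventually_elim
      case (elim \<epsilon>)
      show ?case
        using excess_ratio(1)[OF orb orb' start that, of \<epsilon>] elim
        by (simp add: ce divide_right_mono)
    qed
    then show "d n * exp (- 10 * K * (b m - b n)) \<le> d m"
      by (intro tendsto_le[OF _ d[of m] tendsto_mult[OF d[of n]]]) (auto intro!: tendsto_intros vlim)
    have "\<forall>\<^sub>F \<epsilon> in at_right 0. critical_excess v m \<epsilon> / \<epsilon> \<le> critical_excess v n \<epsilon> / \<epsilon> * exp (5 * K * (?v \<epsilon> m - ?v \<epsilon> n))"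
      using neg[of m] eps_pos
    proof eventually_elim
      case (elim \<epsilon>)
      show ?case
        using excess_ratio(2)[OF orb orb' start that, of \<epsilon>] elim
        by (simp add: ce divide_right_mono)
    qed
    then show "d m \<le> d n * exp (5 * K * (b m - b n))"
      by (intro tendsto_le[OF _ tendsto_mult[OF d[of n]] d[of m]]) (auto intro!: tendsto_intros vlim)
  qed
  have "\<forall>\<^sub>F n in sequentially. -r < b n" using crit(3) by (rule order_tendstoD) (use r_pos in simp)
  then obtain n0 where n0: "\<And>n. n0 \<le> n \<Longrightarrow> -r \<le> b n"
    unfolding eventually_sequentially using less_imp_le by metis
  (* Corrected by this exponential factor the slopes decrease, hence they converge. *)
  define g where "g k = d (k + n0) * exp (- 5 * K * b (k + n0))" for k
  have "decseq g"
  proof (rule decseq_SucI)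
    fix k
    have "g (Suc k) \<le> d (k + n0) * exp (5 * K * (b (Suc k + n0) - b (k + n0))) * exp (- 5 * K * b (Suc k + n0))"
      unfolding g_def using ratio[of "k + n0" "Suc k + n0"] n0 by (intro mult_right_mono) auto
    also have "\<dots> = g k" by (simp add: g_def algebra_simps flip: exp_add)
    finally show "g (Suc k) \<le> g k" .
  qed
  moreover have "\<forall>k. 0 \<le> g k" using dpos n0 by (auto simp: g_def intro!: mult_nonneg_nonneg less_imp_le)
  ultimately obtain c where c: "g \<longlonglongrightarrow> c" using decseq_convergent[of g 0] by metis
  have b0: "(\<lambda>k. b (k + n0)) \<longlonglongrightarrow> 0" by (rule LIMSEQ_ignore_initial_segment[OF crit(3)])
  have "(\<lambda>k. g k * exp (5 * K * b (k + n0))) \<longlonglongrightarrow> c * exp (5 * K * 0)"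
    by (intro tendsto_intros c b0)
  moreover have "(\<lambda>k. g k * exp (5 * K * b (k + n0))) = (\<lambda>k. d (k + n0))"
    by (simp add: g_def fun_eq_iff mult.assoc flip: exp_add)
  ultimately have "(\<lambda>k. d (k + n0)) \<longlonglongrightarrow> c" by simp
  then have dc: "d \<longlonglongrightarrow> c" by (rule LIMSEQ_offset)
  have bounds: "d n * exp (10 * K * b n) \<le> c \<and> c \<le> d n * exp (- 5 * K * b n)" if "-r \<le> b n" for n
  proof
    have "(\<lambda>m. d n * exp (- 10 * K * (b m - b n))) \<longlonglongrightarrow> d n * exp (- 10 * K * (0 - b n))"
      by (intro tendsto_intros crit(3))
    then show "d n * exp (10 * K * b n) \<le> c"
      using LIMSEQ_le[OF _ dc] ratio[of n] that by fastforce
    have "(\<lambda>m. d n * exp (5 * K * (b m - b n))) \<longlonglongrightarrow> d n * exp (5 * K * (0 - b n))"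
      by (intro tendsto_intros crit(3))
    then show "c \<le> d n * exp (- 5 * K * b n)"
      using LIMSEQ_le[OF dc] ratio[of n] that by fastforce
  qed
  have "0 < d n0 * exp (10 * K * b n0)" using dpos[of n0] n0 by simp
  then have "0 < c" using bounds[of n0] n0 by (meson less_le_trans order_refl)
  then show ?thesis using that[of d c] d dpos bounds by blast
qed

end

section \<open>Asymptotics of the free energy\<close>

context local_regime
begin

text \<open>Given a window \<open>\<eta>\<close>, the orbit is observed from a time \<open>n0\<close> on at which the critical orbit is inside
the window. By then the energy is \<open>d\<^sub>n\<^sub>0 * \<epsilon>\<close> to leading order, with \<open>d\<^sub>n\<^sub>0\<close> close to \<open>c\<close>. The
position at that time stays away from \<open>0\<close>, so the whole parabola is passed. If \<open>v\<close> is close to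
\<open>0\<close>, then \<open>n0 = 0\<close> with slope \<open>1\<close> bounds \<open>c\<close> itself.\<close>

lemma free_energy_asymptotics_negative:
  assumes v: "v < 0"
  obtains c where "0 < c" "-r \<le> v \<Longrightarrow> exp (10 * K * v) \<le> c \<and> c \<le> exp (- 5 * K * v)"
    "((\<lambda>\<epsilon>. sqrt \<epsilon> * ln (free_energy \<Psi> (critical_curve \<Psi> v + \<epsilon>) v)) \<longlongrightarrow>
        - (pi * sqrt 2 * ln (Psi_inf \<Psi>) / sqrt c)) (at_right 0)"
proof -
  define h where "h = critical_curve \<Psi> v"
  define a where "a = u_seq \<Psi> h v"
  define b where "b = v_seq \<Psi> h v"
  note crit = critical_orbit[OF v, folded h_def, folded a_def b_def]
  have orb': "is_orbit a b" using is_orbit_seq[of h v] crit(1) by (simp add: a_def b_def)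
  obtain d c where d: "\<And>n. ((\<lambda>\<epsilon>. critical_excess v n \<epsilon> / \<epsilon>) \<longlongrightarrow> d n) (at_right 0)" and c: "0 < c"
    and dc: "\<And>n. -r \<le> b n \<Longrightarrow> 0 < d n \<and> d n * exp (10 * K * b n) \<le> c \<and> c \<le> d n * exp (- 5 * K * b n)"
    using slope_limit[OF v, folded h_def, folded b_def] by blast
  let ?u = "\<lambda>\<epsilon>. u_seq \<Psi> (h + \<epsilon>) v" and ?v = "\<lambda>\<epsilon>. v_seq \<Psi> (h + \<epsilon>) v"
  have orb: "is_orbit (?u \<epsilon>) (?v \<epsilon>)" if "0 < \<epsilon>" for \<epsilon> using is_orbit_seq[of "h+\<epsilon>" v] crit(1) that by simp
  have ce: "critical_excess v n \<epsilon> = excess (?u \<epsilon>) (?v \<epsilon>) a b n" for n \<epsilon>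
    by (simp add: critical_excess_def Let_def h_def a_def b_def)
  have start: "a 0 \<le> ?u \<epsilon> 0" "b 0 \<le> ?v \<epsilon> 0" if "0 < \<epsilon>" for \<epsilon> using that by (auto simp: a_def b_def)
  have eps_pos: "\<forall>\<^sub>F \<epsilon> in at_right (0::real). 0 < \<epsilon>" by (rule eventually_at_right_less)
  have \<epsilon>0: "((\<lambda>\<epsilon>. \<epsilon>) \<longlongrightarrow> 0) (at_right (0::real))" by (rule tendsto_ident_at)
  have vlim: "((\<lambda>\<epsilon>. ?v \<epsilon> n) \<longlongrightarrow> b n) (at_right 0)" for n unfolding b_def by (rule v_seq_right_limit)
  have d0: "d 0 = 1"
  proof -
    have "\<forall>\<^sub>F \<epsilon> in at_right 0. 1 = critical_excess v 0 \<epsilon> / \<epsilon>"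
      using eps_pos by eventually_elim (simp add: ce excess_def energy_def a_def b_def)
    then have "((\<lambda>\<epsilon>. critical_excess v 0 \<epsilon> / \<epsilon>) \<longlongrightarrow> 1) (at_right 0)"
      by (rule Lim_transform_eventually[OF tendsto_const])
    then show ?thesis using d[of 0] tendsto_unique trivial_limit_at_right_real by blast
  qed
  define C where "C = pi * sqrt 2 * ln (Psi_inf \<Psi>) / sqrt c"
  have C: "0 < C" using c Psi_inf_gt_1 by (simp add: C_def)
  have "((\<lambda>\<epsilon>. sqrt \<epsilon> * ln (free_energy \<Psi> (h + \<epsilon>) v)) \<longlongrightarrow> - C) (at_right 0)"
  proof (rule tendsto_of_eventual_bounds[OF r_pos, where
        lo = "\<lambda>\<eta>. - (C * exp (5 * K * \<eta>)) / (1 - 50 * K * \<eta>) - \<eta>" and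
        hi = "\<lambda>\<eta>. - (C * exp (- 5 * K * \<eta>)) / (1 + 50 * K * \<eta>) + \<eta>"])
    have "((\<lambda>\<eta>. - (C * exp (5 * K * \<eta>)) / (1 - 50 * K * \<eta>) - \<eta>) \<longlongrightarrow>
        - (C * exp (5 * K * 0)) / (1 - 50 * K * 0) - 0) (at_right 0)"
      by (intro tendsto_intros) auto
    then show "((\<lambda>\<eta>. - (C * exp (5 * K * \<eta>)) / (1 - 50 * K * \<eta>) - \<eta>) \<longlongrightarrow> - C) (at_right 0)" by simp
    have "((\<lambda>\<eta>. - (C * exp (- 5 * K * \<eta>)) / (1 + 50 * K * \<eta>) + \<eta>) \<longlongrightarrow>
        - (C * exp (- 5 * K * 0)) / (1 + 50 * K * 0) + 0) (at_right 0)"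
      by (intro tendsto_intros) auto
    then show "((\<lambda>\<eta>. - (C * exp (- 5 * K * \<eta>)) / (1 + 50 * K * \<eta>) + \<eta>) \<longlongrightarrow> - C) (at_right 0)" by simp
  next
    fix \<eta> assume \<eta>: "0 < \<eta>" "\<eta> \<le> r"
    have "\<forall>\<^sub>F n in sequentially. -\<eta> < b n" using crit(3) by (rule order_tendstoD) (use \<eta> in simp)
    then obtain n0 where n0: "-\<eta> \<le> b n0" by (metis eventually_sequentially less_imp_le order_refl)
    have bn: "-r \<le> b n0" using n0 \<eta> by simp
    define \<delta> where "\<delta> = critical_excess v n0"
    have dpos: "0 < d n0" using dc[OF bn] by simp
    have "((\<lambda>\<epsilon>. \<delta> \<epsilon> / \<epsilon> * \<epsilon>) \<longlongrightarrow> d n0 * 0) (at_right 0)"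
      unfolding \<delta>_def by (intro tendsto_mult d \<epsilon>0)
    from this[unfolded mult_zero_right] have \<delta>0: "(\<delta> \<longlongrightarrow> 0) (at_right 0)"
      by (rule Lim_transform_eventually) (use eps_pos in \<open>eventually_elim, simp\<close>)
    have "\<forall>\<^sub>F \<epsilon> in at_right 0. 0 < \<delta> \<epsilon> / \<epsilon>"
      unfolding \<delta>_def by (rule order_tendstoD(1)[OF d dpos])
    then have \<delta>pos: "\<forall>\<^sub>F \<epsilon> in at_right 0. 0 < \<delta> \<epsilon>"
      using eps_pos by eventually_elim (simp add: zero_less_divide_iff)
    have \<delta>small: "\<forall>\<^sub>F \<epsilon> in at_right 0. \<delta> \<epsilon> < 1/16" by (rule order_tendstoD(2)[OF \<delta>0]) simp
    have neg: "\<forall>\<^sub>F \<epsilon> in at_right 0. ?v \<epsilon> n0 < 0" by (rule order_tendstoD(2)[OF vlim crit(2)])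
    have ev: "\<forall>\<^sub>F \<epsilon> in at_right 0. 0 \<le> h + \<epsilon> \<and> 0 < \<delta> \<epsilon> \<and>
       -\<eta> \<le> v_seq \<Psi> (h + \<epsilon>) v n0 \<and> v_seq \<Psi> (h + \<epsilon>) v n0 \<le> 0 \<and>
       filterlim (v_seq \<Psi> (h + \<epsilon>) v) at_top sequentially \<and>
       (\<forall>n\<ge>n0. v_seq \<Psi> (h + \<epsilon>) v n \<le> \<eta> \<longrightarrow>
          \<bar>u_seq \<Psi> (h + \<epsilon>) v n - (\<delta> \<epsilon> + (v_seq \<Psi> (h + \<epsilon>) v n)\<^sup>2 / 2)\<bar>
            \<le> 40 * K * \<eta> * (\<delta> \<epsilon> + (v_seq \<Psi> (h + \<epsilon>) v n)\<^sup>2 / 2))"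
      using \<delta>pos \<delta>small neg eps_pos
    proof eventually_elim
      case (elim \<epsilon>)
      note o = orb[OF elim(4)] and st = start[OF elim(4)]
      have vn0: "-\<eta> \<le> ?v \<epsilon> n0" using v_ge[OF o orb' st, of n0] n0 by simp
      have "\<bar>?u \<epsilon> n - (\<delta> \<epsilon> + (?v \<epsilon> n)\<^sup>2 / 2)\<bar> \<le> 40 * K * \<eta> * (\<delta> \<epsilon> + (?v \<epsilon> n)\<^sup>2 / 2)"
        if "n0 \<le> n" "?v \<epsilon> n \<le> \<eta>" for n
      proof (rule near_parabola[OF o \<eta> _ _ vn0 _ _ _ that])
        fix n assume n: "n0 \<le> n" "?v \<epsilon> n \<le> 0"
        note el = energy_left[OF o orb' st crit(4,3) less_imp_le[OF crit(2)] \<eta> n0 n]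
        show "energy (?u \<epsilon>) (?v \<epsilon>) n \<le> (1 + 10 * K * \<eta>) * \<delta> \<epsilon>"
          using el(1) by (simp add: \<delta>_def ce)
        show "(1 - 22 * K * \<eta>) * \<delta> \<epsilon> - 2 * \<eta> * (?v \<epsilon> n)\<^sup>2 \<le> energy (?u \<epsilon>) (?v \<epsilon>) n"
          using el(2) by (simp add: \<delta>_def ce)
      qed (use elim in auto)
      then show ?case using elim crit(1) vn0 crit(5)[of "h + \<epsilon>"] by simp
    qed
    have "((\<lambda>\<epsilon>. sqrt (2 * \<delta> \<epsilon>)) \<longlongrightarrow> sqrt (2 * 0)) (at_right 0)" by (intro tendsto_intros \<delta>0)
    moreover have "\<forall>\<^sub>F \<epsilon> in at_right 0. 0 < sqrt (2 * \<delta> \<epsilon>)" using \<delta>pos by eventually_elim simp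
    ultimately have "filterlim (\<lambda>\<epsilon>. - ?v \<epsilon> n0 / sqrt (2 * \<delta> \<epsilon>)) at_top (at_right 0)"
      using crit(2)[of n0] by (intro LIM_at_top_divide[OF tendsto_minus[OF vlim]]) auto
    then have "((\<lambda>\<epsilon>. arctan (- ?v \<epsilon> n0 / sqrt (2 * \<delta> \<epsilon>))) \<longlongrightarrow> pi / 2) (at_right 0)"
      by (rule filterlim_compose[OF tendsto_arctan_at_top])
    then have "((\<lambda>\<epsilon>. - arctan (- ?v \<epsilon> n0 / sqrt (2 * \<delta> \<epsilon>))) \<longlongrightarrow> - (pi / 2)) (at_right 0)"
      by (rule tendsto_minus)
    then have phase: "((\<lambda>\<epsilon>. arctan (?v \<epsilon> n0 / sqrt (2 * \<delta> \<epsilon>))) \<longlongrightarrow> - (pi / 2)) (at_right 0)"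
      by (simp add: arctan_minus)
    define X where "X = sqrt 2 * (pi / 2 + pi / 2) / sqrt (d n0) * ln (Psi_inf \<Psi>)"
    have main: "\<forall>\<^sub>F \<epsilon> in at_right 0.
      - X / (1 - 50 * K * \<eta>) - \<eta> \<le> sqrt \<epsilon> * ln (free_energy \<Psi> (h + \<epsilon>) v) \<and>
      sqrt \<epsilon> * ln (free_energy \<Psi> (h + \<epsilon>) v) \<le> - X / (1 + 50 * K * \<eta>) + \<eta>"
      unfolding X_def
      by (rule log_free_energy_asymptotics[OF \<eta> ev dpos _ phase]) (simp add: \<delta>_def d)
    have XC: "X = C * sqrt (c / d n0)"
      using c dpos by (simp add: X_def C_def real_sqrt_divide)
    have Kb: "- K * b n0 \<le> K * \<eta>" "0 \<le> - K * b n0"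
      using mult_left_mono[of "- b n0" \<eta> K] n0 K_ge_1 crit(2)[of n0] by (auto simp: mult_nonneg_nonpos)
    have "c / d n0 \<le> exp (- 5 * K * b n0)" using dc[OF bn] dpos by (simp add: divide_le_eq mult.commute)
    also have "\<dots> \<le> (exp (5 * K * \<eta>))\<^sup>2" using Kb by (simp flip: exp_double)
    finally have "sqrt (c / d n0) \<le> exp (5 * K * \<eta>)" using real_le_lsqrt by simp
    then have X1: "X \<le> C * exp (5 * K * \<eta>)" unfolding XC using C by (intro mult_left_mono) auto
    have "(exp (- 5 * K * \<eta>))\<^sup>2 \<le> exp (10 * K * b n0)" using Kb by (simp flip: exp_double)
    also have "\<dots> \<le> c / d n0" using dc[OF bn] dpos by (simp add: le_divide_eq mult.commute)
    finally have "exp (- 5 * K * \<eta>) \<le> sqrt (c / d n0)" by (rule real_le_rsqrt)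
    then have X2: "C * exp (- 5 * K * \<eta>) \<le> X" unfolding XC using C by (intro mult_left_mono) auto
    have "0 < 1 - 50 * K * \<eta>" "0 < 1 + 50 * K * \<eta>" using K_eta[OF \<eta>] by auto
    then have Y: "- (C * exp (5 * K * \<eta>)) / (1 - 50 * K * \<eta>) \<le> - X / (1 - 50 * K * \<eta>)"
      "- X / (1 + 50 * K * \<eta>) \<le> - (C * exp (- 5 * K * \<eta>)) / (1 + 50 * K * \<eta>)"
      using X1 X2 by (intro divide_right_mono; simp)+
    show "\<forall>\<^sub>F \<epsilon> in at_right 0. - (C * exp (5 * K * \<eta>)) / (1 - 50 * K * \<eta>) - \<eta>
           \<le> sqrt \<epsilon> * ln (free_energy \<Psi> (h + \<epsilon>) v) \<and>
          sqrt \<epsilon> * ln (free_energy \<Psi> (h + \<epsilon>) v) \<le> - (C * exp (- 5 * K * \<eta>)) / (1 + 50 * K * \<eta>) + \<eta>"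
      using main by eventually_elim (use Y in linarith)
  qed
  moreover have "exp (10 * K * v) \<le> c \<and> c \<le> exp (- 5 * K * v)" if "-r \<le> v"
    using dc[of 0] that d0 by (simp add: b_def)
  ultimately show ?thesis using that[of c] c by (simp add: C_def h_def)
qed

text \<open>Started at \<open>(\<epsilon>, 0)\<close> the orbit has energy exactly \<open>\<epsilon>\<close> and passes only the right half of the parabola.\<close>

lemma free_energy_asymptotics_zero:
  "((\<lambda>\<epsilon>. sqrt \<epsilon> * ln (free_energy \<Psi> \<epsilon> 0)) \<longlongrightarrow> - (pi / sqrt 2 * ln (Psi_inf \<Psi>))) (at_right 0)"
proof (rule tendsto_of_eventual_bounds[OF r_pos])
  define X where "X = sqrt 2 * (pi / 2 + 0) / sqrt 1 * ln (Psi_inf \<Psi>)"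
  have X: "X = pi / sqrt 2 * ln (Psi_inf \<Psi>)"
    by (simp add: X_def real_div_sqrt field_simps) 
  have "((\<lambda>\<eta>. - X / (1 - 50 * K * \<eta>) - \<eta>) \<longlongrightarrow> - X / (1 - 50 * K * 0) - 0) (at_right 0)"
    by (intro tendsto_intros) auto
  then show "((\<lambda>\<eta>. - X / (1 - 50 * K * \<eta>) - \<eta>) \<longlongrightarrow> - (pi / sqrt 2 * ln (Psi_inf \<Psi>))) (at_right 0)"
    by (simp add: X)
  have "((\<lambda>\<eta>. - X / (1 + 50 * K * \<eta>) + \<eta>) \<longlongrightarrow> - X / (1 + 50 * K * 0) + 0) (at_right 0)"
    by (intro tendsto_intros) auto
  then show "((\<lambda>\<eta>. - X / (1 + 50 * K * \<eta>) + \<eta>) \<longlongrightarrow> - (pi / sqrt 2 * ln (Psi_inf \<Psi>))) (at_right 0)"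
    by (simp add: X)
  fix \<eta> assume \<eta>: "0 < \<eta>" "\<eta> \<le> r"
  have ev: "\<forall>\<^sub>F \<epsilon> in at_right 0. 0 \<le> \<epsilon> \<and> 0 < \<epsilon> \<and>
       -\<eta> \<le> v_seq \<Psi> \<epsilon> 0 0 \<and> v_seq \<Psi> \<epsilon> 0 0 \<le> 0 \<and>
       filterlim (v_seq \<Psi> \<epsilon> 0) at_top sequentially \<and>
       (\<forall>n\<ge>0. v_seq \<Psi> \<epsilon> 0 n \<le> \<eta> \<longrightarrow>
          \<bar>u_seq \<Psi> \<epsilon> 0 n - (\<epsilon> + (v_seq \<Psi> \<epsilon> 0 n)\<^sup>2 / 2)\<bar>
            \<le> 40 * K * \<eta> * (\<epsilon> + (v_seq \<Psi> \<epsilon> 0 n)\<^sup>2 / 2))"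
  proof -
    have "\<forall>\<^sub>F \<epsilon> in at_right (0::real). 0 < \<epsilon> \<and> \<epsilon> \<le> 1/16"
      by (auto simp: eventually_at_right_field intro!: exI[of _ "1/16"])
    then show ?thesis
    proof eventually_elim
      case (elim \<epsilon>)
      have orb: "is_orbit (u_seq \<Psi> \<epsilon> 0) (v_seq \<Psi> \<epsilon> 0)" using elim by (simp add: is_orbit_seq)
      have v1: "0 < v_seq \<Psi> \<epsilon> 0 1" using elim by (simp add: seq_Suc(1))
      have n0: "n = 0" if "v_seq \<Psi> \<epsilon> 0 n \<le> 0" for n
      proof (rule ccontr)
        assume "n \<noteq> 0"
        then have "v_seq \<Psi> \<epsilon> 0 1 \<le> v_seq \<Psi> \<epsilon> 0 n" by (intro v_mono[OF orb]) simp
        then show False using v1 that by simp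
      qed
      have \<epsilon>K: "0 \<le> K * \<eta> * \<epsilon>" using \<eta> K_ge_1 elim by simp
      have "\<bar>u_seq \<Psi> \<epsilon> 0 n - (\<epsilon> + (v_seq \<Psi> \<epsilon> 0 n)\<^sup>2 / 2)\<bar>
            \<le> 40 * K * \<eta> * (\<epsilon> + (v_seq \<Psi> \<epsilon> 0 n)\<^sup>2 / 2)" if "v_seq \<Psi> \<epsilon> 0 n \<le> \<eta>" for n
      proof (rule near_parabola[OF orb \<eta> _ _ _ _ _ _ le0 that])
        fix m assume "v_seq \<Psi> \<epsilon> 0 m \<le> 0"
        then have m: "m = 0" by (rule n0)
        show "energy (u_seq \<Psi> \<epsilon> 0) (v_seq \<Psi> \<epsilon> 0) m \<le> (1 + 10 * K * \<eta>) * \<epsilon>"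
          "(1 - 22 * K * \<eta>) * \<epsilon> - 2 * \<eta> * (v_seq \<Psi> \<epsilon> 0 m)\<^sup>2 \<le> energy (u_seq \<Psi> \<epsilon> 0) (v_seq \<Psi> \<epsilon> 0) m"
          unfolding m using \<epsilon>K by (simp_all add: energy_def G_0 algebra_simps)
      qed (use elim \<eta> in auto)
      moreover have "filterlim (v_seq \<Psi> \<epsilon> 0) at_top sequentially"
        using diverges[OF orb _ v1] elim by simp
      ultimately show ?case using elim \<eta> by simp
    qed
  qed
  have "((\<lambda>\<epsilon>. \<epsilon> / \<epsilon>) \<longlongrightarrow> 1) (at_right (0::real))"
    by (rule Lim_transform_eventually[OF tendsto_const])
       (auto simp: eventually_at_right_field intro!: exI[of _ 1])
  then show "\<forall>\<^sub>F \<epsilon> in at_right 0. - X / (1 - 50 * K * \<eta>) - \<eta> \<le> sqrt \<epsilon> * ln (free_energy \<Psi> \<epsilon> 0) \<and>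
      sqrt \<epsilon> * ln (free_energy \<Psi> \<epsilon> 0) \<le> - X / (1 + 50 * K * \<eta>) + \<eta>"
    unfolding X_def
    by (intro log_free_energy_asymptotics[OF \<eta> ev]) auto
qed

end

theorem theorem1p3:
  fixes \<Psi> :: "real \<Rightarrow> real"
  assumes "\<And>x. \<Psi> x > 0"
    and "bounded (range \<Psi>)"
    and "mono \<Psi>"
    and "C2_real \<Psi>"
    and "\<Psi> 0 = 1"
    and "deriv \<Psi> 0 = 1"
    and "\<And>\<kappa>::real. \<kappa> > 1 \<Longrightarrow> summable (\<lambda>j. Psi_inf \<Psi> - \<Psi> (\<kappa> ^ Suc j))"
  shows "\<exists>C :: real \<Rightarrow> real.
      (\<forall>v\<le>0. C v > 0 \<and>
         ((\<lambda>\<epsilon>. \<epsilon> powr (1/2) * ln (free_energy \<Psi> (critical_curve \<Psi> v + \<epsilon>) v))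
            \<longlongrightarrow> - C v) (at_right 0)) \<and>
      (\<exists>L. (C \<longlongrightarrow> L) (at_left 0) \<and> C 0 = 1 / 2 * L) \<and>
      C 0 = pi / sqrt 2 * ln (Psi_inf \<Psi>)"
proof -
  interpret recursion \<Psi> by unfold_locales (fact assms)+
  obtain G K r where "local_regime \<Psi> G K r" using local_regime_exists by blast
  then interpret local_regime \<Psi> G K r .
  define P where "P = ln (Psi_inf \<Psi>)"
  have P: "0 < P" using Psi_inf_gt_1 by (simp add: P_def)
  define good where "good v c \<longleftrightarrow> 0 < c \<and> (-r \<le> v \<longrightarrow> exp (10 * K * v) \<le> c \<and> c \<le> exp (- 5 * K * v)) \<and>
    ((\<lambda>\<epsilon>. sqrt \<epsilon> * ln (free_energy \<Psi> (critical_curve \<Psi> v + \<epsilon>) v)) \<longlongrightarrow>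
        - (pi * sqrt 2 * P / sqrt c)) (at_right 0)" for v c
  have "\<exists>c. v < 0 \<longrightarrow> good v c" for v
  proof (cases "v < 0")
    case True
    obtain c where "0 < c" "-r \<le> v \<Longrightarrow> exp (10 * K * v) \<le> c \<and> c \<le> exp (- 5 * K * v)"
      "((\<lambda>\<epsilon>. sqrt \<epsilon> * ln (free_energy \<Psi> (critical_curve \<Psi> v + \<epsilon>) v)) \<longlongrightarrow>
        - (pi * sqrt 2 * ln (Psi_inf \<Psi>) / sqrt c)) (at_right 0)"
      using free_energy_asymptotics_negative[OF True] by blast
    then have "good v c" by (simp add: good_def P_def)
    then show ?thesis by blast
  qed simp
  then obtain c where good: "\<And>v. v < 0 \<Longrightarrow> good v (c v)" by metis
  have c: "\<And>v. v < 0 \<Longrightarrow> 0 < c v"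
    "\<And>v. v < 0 \<Longrightarrow> -r \<le> v \<Longrightarrow> exp (10 * K * v) \<le> c v \<and> c v \<le> exp (- 5 * K * v)"
    "\<And>v. v < 0 \<Longrightarrow> ((\<lambda>\<epsilon>. sqrt \<epsilon> * ln (free_energy \<Psi> (critical_curve \<Psi> v + \<epsilon>) v)) \<longlongrightarrow>
        - (pi * sqrt 2 * P / sqrt (c v))) (at_right 0)"
    using good by (simp_all add: good_def)
  define C where "C v = (if v = 0 then pi / sqrt 2 * P else pi * sqrt 2 * P / sqrt (c v))" for v
  have powr: "((\<lambda>\<epsilon>. \<epsilon> powr (1/2) * f \<epsilon>) \<longlongrightarrow> l) (at_right 0)"
    if "((\<lambda>\<epsilon>. sqrt \<epsilon> * f \<epsilon>) \<longlongrightarrow> l) (at_right 0)" for f :: "real \<Rightarrow> real" and l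
  proof (rule Lim_transform_eventually[OF that])
    show "\<forall>\<^sub>F \<epsilon> in at_right 0. sqrt \<epsilon> * f \<epsilon> = \<epsilon> powr (1/2) * f \<epsilon>"
      using eventually_at_right_less[of "0::real"] by eventually_elim (simp add: powr_half_sqrt)
  qed
  have "C v > 0 \<and> ((\<lambda>\<epsilon>. \<epsilon> powr (1/2) * ln (free_energy \<Psi> (critical_curve \<Psi> v + \<epsilon>) v))
            \<longlongrightarrow> - C v) (at_right 0)" if "v \<le> 0" for v
  proof (cases "v = 0")
    case True
    then show ?thesis
      using P powr[OF free_energy_asymptotics_zero] by (simp add: C_def critical_curve_0 P_def)
  next
    case False
    then show ?thesis using that P c(1)[of v] powr[OF c(3)[of v]] by (simp add: C_def)
  qed
  moreover have "(C \<longlongrightarrow> pi * sqrt 2 * P) (at_left 0)"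
  proof -
    have near: "\<forall>\<^sub>F v in at_left 0. -r \<le> v \<and> v < 0"
      using r_pos by (auto simp: eventually_at_left_field intro!: exI[of _ "-r"])
    have "(c \<longlongrightarrow> 1) (at_left 0)"
    proof (rule tendsto_sandwich)
      show "\<forall>\<^sub>F v in at_left 0. exp (10 * K * v) \<le> c v" "\<forall>\<^sub>F v in at_left 0. c v \<le> exp (- 5 * K * v)"
        using near by (eventually_elim, use c(2) in blast)+
      have "((\<lambda>v. exp (10 * K * v)) \<longlongrightarrow> exp (10 * K * 0)) (at_left 0)" by (intro tendsto_intros)
      then show "((\<lambda>v. exp (10 * K * v)) \<longlongrightarrow> 1) (at_left 0)" by simp
      have "((\<lambda>v. exp (- 5 * K * v)) \<longlongrightarrow> exp (- 5 * K * 0)) (at_left 0)" by (intro tendsto_intros)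
      then show "((\<lambda>v. exp (- 5 * K * v)) \<longlongrightarrow> 1) (at_left 0)" by simp
    qed
    then have "((\<lambda>v. pi * sqrt 2 * P / sqrt (c v)) \<longlongrightarrow> pi * sqrt 2 * P / sqrt 1) (at_left 0)"
      by (intro tendsto_intros) auto
    moreover have "\<forall>\<^sub>F v in at_left 0. pi * sqrt 2 * P / sqrt (c v) = C v"
      using near by eventually_elim (simp add: C_def)
    ultimately have "(C \<longlongrightarrow> pi * sqrt 2 * P / sqrt 1) (at_left 0)"
      by (rule Lim_transform_eventually)
    then show ?thesis by simp
  qed
  moreover have "C 0 = 1 / 2 * (pi * sqrt 2 * P)"
    by (simp add: C_def field_simps)
  moreover have "C 0 = pi / sqrt 2 * ln (Psi_inf \<Psi>)" by (simp add: C_def P_def)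
  ultimately show ?thesis by blast
qed

end
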